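(* Let $F$ be a finite field of characteristic $p$ with $|F|=q=p^k$ and let $G=C_3 \rtimes Q_8$. If $p>3$, then $$U(FG) \cong \begin{cases} C_{p^k-1}^4 \times GL(2,F)^5, & \text{if } q \equiv \pm 1 \bmod 12;\\ C_{p^k-1}^4 \times GL(2, F)^3 \times GL(2, F_2), & \text{if } q \equiv \pm 5 \bmod 12.\end{cases}$$
   Context: $FG$ denotes the group algebra of a finite group $G$ over $F$, and $U(FG)$ its group of units. $C_n$ is the cyclic group of order $n$, $Q_8$ is the quaternion group of order $8$, and $H^m$ denotes the direct product of $m$ copies of a group $H$. $F_2$ denotes the extension field of $F$ of degree $2$ (so $|F_2|=q^2$). The group $C_3 \rtimes Q_8$ is the group of order $24$ with presentation $\langle x, y \mid x^{12}=1,\ x^6=y^2,\ yxy^{-1}=x^{-1} \rangle$. *)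

theory Defs
  imports
    "HOL-Computational_Algebra.Computational_Algebra"
    "HOL-Library.Cardinality"
    "HOL-Number_Theory.Cong"
    "HOL-Algebra.Elementary_Groups"
    "HOL-Algebra.Product_Groups"
    "Jordan_Normal_Form.Matrix"
begin

section \<open>Group presentations\<close>

text \<open>A letter \<open>(a, True)\<close> stands for the generator \<open>a\<close>, and \<open>(a, False)\<close> for its inverse.
  The relation \<open>word_cong R\<close> is the congruence on words whose quotient is the group presented by
  the equations \<open>u = v\<close>, \<open>(u, v) \<in> R\<close>.\<close>

type_synonym 'a word = "('a \<times> bool) list"

inductive word_cong :: "('a word \<times> 'a word) set \<Rightarrow> 'a word \<Rightarrow> 'a word \<Rightarrow> bool"
  for R where
  cancel: "word_cong R (u @ [(a, b), (a, \<not> b)] @ v) (u @ v)"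
| relation: "(l, r) \<in> R \<Longrightarrow> word_cong R (u @ l @ v) (u @ r @ v)"
| refl: "word_cong R u u"
| sym: "word_cong R u v \<Longrightarrow> word_cong R v u"
| trans: "word_cong R u v \<Longrightarrow> word_cong R v w \<Longrightarrow> word_cong R u w"

primrec word_eval :: "('g, 'm) monoid_scheme \<Rightarrow> ('a \<Rightarrow> 'g) \<Rightarrow> 'a word \<Rightarrow> 'g" where
  "word_eval G f [] = \<one>\<^bsub>G\<^esub>"
| "word_eval G f (s # w) =
     (if snd s then f (fst s) else inv\<^bsub>G\<^esub> f (fst s)) \<otimes>\<^bsub>G\<^esub> word_eval G f w"

text \<open>\<open>G\<close> is presented by \<open>R\<close>, with the abstract generator \<open>a\<close> realised as \<open>f a\<close>: equivalently,
  evaluation of words induces an isomorphism from the quotient by \<open>word_cong R\<close> onto \<open>G\<close>.\<close>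

definition presented_by ::
    "('g, 'm) monoid_scheme \<Rightarrow> ('a \<Rightarrow> 'g) \<Rightarrow> ('a word \<times> 'a word) set \<Rightarrow> bool" where
  "presented_by G f R \<longleftrightarrow>
     Group.group G \<and> range f \<subseteq> carrier G \<and> generate G (range f) = carrier G \<and>
     (\<forall>u v. word_eval G f u = word_eval G f v \<longleftrightarrow> word_cong R u v)"

datatype xy = gen_x | gen_y

text \<open>The relations \<open>x^12 = 1\<close>, \<open>x^6 = y^2\<close>, \<open>y x y^{-1} = x^{-1}\<close>.\<close>

definition C3_Q8_relations :: "(xy word \<times> xy word) set" where
  "C3_Q8_relations =
     {(replicate 12 (gen_x, True), []),
      (replicate 6 (gen_x, True), replicate 2 (gen_y, True)),
      ([(gen_y, True), (gen_x, True), (gen_y, False)], [(gen_x, False)])}"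

definition is_C3_semidirect_Q8 :: "('g, 'm) monoid_scheme \<Rightarrow> bool" where
  "is_C3_semidirect_Q8 G \<longleftrightarrow> (\<exists>f. presented_by G f C3_Q8_relations)"


section \<open>Group algebras and the groups in the decomposition\<close>

text \<open>The group algebra of a finite group \<open>G\<close>: the element \<open>\<Sum>g. a g \<cdot> g\<close> is represented by its
  coefficient function \<open>a\<close>, which is zero outside the carrier. For infinite \<open>G\<close> this would not be
  the group algebra, since finite support is not imposed.\<close>

definition group_algebra ::
    "'f::field itself \<Rightarrow> ('g, 'm) monoid_scheme \<Rightarrow> ('g \<Rightarrow> 'f) ring" where
  "group_algebra ty G =
     \<lparr>carrier = {a. \<forall>g. g \<notin> carrier G \<longrightarrow> a g = 0},
      mult = (\<lambda>a b g. if g \<in> carrier G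
                 then \<Sum>h\<in>carrier G. a h * b (inv\<^bsub>G\<^esub> h \<otimes>\<^bsub>G\<^esub> g) else 0),
      one = (\<lambda>g. if g = \<one>\<^bsub>G\<^esub> then 1 else 0),
      zero = (\<lambda>g. 0),
      add = (\<lambda>a b g. a g + b g)\<rparr>"

definition GL :: "nat \<Rightarrow> 'f::field itself \<Rightarrow> 'f mat monoid" where
  "GL n ty = units_of (ring_mat ty n ())"

definition group_power :: "('g, 'm) monoid_scheme \<Rightarrow> nat \<Rightarrow> (nat \<Rightarrow> 'g) monoid" where
  "group_power H m = product_group {..<m} (\<lambda>_. H)"

text \<open>The homomorphism \<open>\<iota>\<close> makes \<open>'e\<close> an extension field of \<open>'f\<close> of degree \<open>n\<close>; as \<open>dim\<close> is \<open>0\<close> for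
  infinite-dimensional spaces, this is meant for \<open>n > 0\<close>.\<close>

definition field_extension_of_degree :: "nat \<Rightarrow> ('f::field \<Rightarrow> 'e::field) \<Rightarrow> bool" where
  "field_extension_of_degree n \<iota> \<longleftrightarrow>
     field_hom \<iota> \<and> vector_space.dim (\<lambda>c v. \<iota> c * v) (UNIV :: 'e set) = n"

end

theory Submission
  imports Defs "HOL-Algebra.Multiplicative_Group"
begin

text \<open>\<open>G\<close> has four linear characters and, for every \<open>t\<close> with \<open>t (t\<^sup>2 - 1) (t\<^sup>2 - 3) = 0\<close>, a
  representation of degree 2 in which \<open>x\<close> acts with determinant \<open>1\<close> and trace \<open>t\<close> (so \<open>t\<close> plays the
  role of \<open>\<omega>\<^sup>j + \<omega>\<^sup>-\<^sup>j\<close> for a primitive 12th root of unity \<open>\<omega>\<close>). It is defined over any field that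
  contains \<open>t\<close> and on which \<open>-1\<close> is a sum of two squares, in particular over every finite field
  containing \<open>t\<close>. Extended linearly to the group algebra, these representations are jointly injective,
  because the character of the regular representation is a combination of theirs and 24 is
  invertible. Comparing cardinalities, they give an isomorphism onto the product of the matrix algebras,
  and units correspond to units. Finally \<open>3\<close> is a square in \<open>F\<close> iff \<open>-1\<close> and \<open>-3\<close> are both squares or
  both nonsquares, that is, iff \<open>q \<equiv> \<plusminus>1 (mod 12)\<close>; otherwise the two representations with
  \<open>t = \<plusminus>\<surd>3\<close> are conjugate over \<open>F\<^sub>2\<close>, and one of them contributes the factor over \<open>F\<^sub>2\<close>.\<close>

section \<open>Squares in finite fields\<close>

text \<open>Repackages a type-class field as a ring record, so that the cyclicity of the
  multiplicative group of a finite field, which is stated for records, can be applied.\<close>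

definition field_ring :: "'a::field itself \<Rightarrow> 'a ring" where
  "field_ring ty = \<lparr>carrier = UNIV, mult = (*), one = 1, zero = 0, add = (+)\<rparr>"

lemma field_field_ring: "Ring.field (field_ring TYPE('a::field))"
proof -
  have "cring (field_ring TYPE('a))"
  proof (rule cringI)
    show "abelian_group (field_ring TYPE('a))"
    proof (rule abelian_groupI)
      fix x assume "x \<in> carrier (field_ring TYPE('a))"
      show "\<exists>y\<in>carrier (field_ring TYPE('a)). y \<oplus>\<^bsub>field_ring TYPE('a)\<^esub> x = \<zero>\<^bsub>field_ring TYPE('a)\<^esub>"
        by (rule bexI[of _ "- x"]) (auto simp: field_ring_def)
    qed (auto simp: field_ring_def)
    show "Group.comm_monoid (field_ring TYPE('a))"
      by unfold_locales (auto simp: field_ring_def)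
  qed (auto simp: field_ring_def algebra_simps)
  then show ?thesis
  proof (rule cring.cring_fieldI2)
    fix a assume "a \<in> carrier (field_ring TYPE('a))" "a \<noteq> \<zero>\<^bsub>field_ring TYPE('a)\<^esub>"
    then show "\<exists>b\<in>carrier (field_ring TYPE('a)). a \<otimes>\<^bsub>field_ring TYPE('a)\<^esub> b = \<one>\<^bsub>field_ring TYPE('a)\<^esub>"
      by (intro bexI[of _ "inverse a"]) (auto simp: field_ring_def)
  qed (auto simp: field_ring_def)
qed

lemma field_ring_pow:
  fixes x :: "'a::field"
  shows "x [^]\<^bsub>field_ring TYPE('a)\<^esub> (n::nat) = x ^ n"
  by (induction n) (simp_all add: field_ring_def mult.commute)

text \<open>The powers of a generator \<open>g\<close> below its order are distinct and exhaust the
  nonzero elements, so the order is the number of nonzero elements. In this form, questions about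
  roots become arithmetic with exponents.\<close>

lemma finite_field_generator:
  assumes fin: "finite (UNIV :: 'a::field set)"
  obtains g :: "'a::field" where "g \<noteq> 0"
    and "\<And>i j. g ^ i = g ^ j \<longleftrightarrow> [i = j] (mod CARD('a) - 1)"
    and "\<And>x. x \<noteq> 0 \<Longrightarrow> \<exists>i<CARD('a) - 1. x = g ^ i"
proof -
  define n where "n = CARD('a) - 1"
  have card_nz: "card (UNIV - {0 :: 'a}) = n"
    using fin by (simp add: n_def card_Diff_singleton)
  have "n > 0"
    using card_nz fin by (metis DiffI UNIV_I card_gt_0_iff empty_iff finite_Diff singletonD zero_neq_one)
  interpret R: Ring.field "field_ring TYPE('a)" by (rule field_field_ring)
  have [simp]: "carrier (field_ring TYPE('a)) = UNIV" "\<zero>\<^bsub>field_ring TYPE('a)\<^esub> = 0"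
    by (simp_all add: field_ring_def)
  obtain g :: 'a where g: "g \<noteq> 0" and gen: "UNIV - {0} = {g ^ i | i::nat. i \<in> UNIV}"
    using R.finite_field_mult_group_has_gen fin by (auto simp: field_ring_pow nat_pow_mult_of)
  \<comment> \<open>Pigeonhole: some positive power of \<open>g\<close> is 1, so the order
    \<open>m\<close> below is well defined.\<close>
  have "\<not> inj (\<lambda>i. g ^ i)"
    using fin finite_imageD[of "\<lambda>i. g ^ i" UNIV] infinite_UNIV_nat
    by (meson finite_subset subset_UNIV)
  then obtain i j where "i < j" "g ^ i = g ^ j"
    unfolding inj_def by (metis linorder_neqE_nat)
  then have "g ^ (j - i) = 1" "j - i > 0"
    using g by (auto simp: power_diff)
  define m where "m = (LEAST k. k > 0 \<and> g ^ k = 1)"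
  have m: "m > 0" "g ^ m = 1"
    using LeastI[of "\<lambda>k. k > 0 \<and> g ^ k = 1" "j - i"] \<open>g ^ (j - i) = 1\<close> \<open>j - i > 0\<close>
    unfolding m_def by auto
  have least: "k = 0" if "g ^ k = 1" "k < m" for k
    using not_less_Least[of k "\<lambda>k. k > 0 \<and> g ^ k = 1"] that unfolding m_def by auto
  have red: "g ^ k = g ^ (k mod m)" for k
  proof -
    have "g ^ k = g ^ (m * (k div m) + k mod m)" by simp
    also have "\<dots> = g ^ (k mod m)" using m by (simp only: power_add power_mult) simp
    finally show ?thesis .
  qed
  have inj: "i = j" if "g ^ i = g ^ j" "i < m" "j < m" for i j
    using that
  proof (induction i j rule: linorder_wlog)
    case (le i j)
    then have "g ^ (j - i) = 1" using g by (simp add: power_diff)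
    then show ?case using least[of "j - i"] le by (metis diff_is_0_eq less_imp_diff_less nle_le)
  qed auto
  have img: "UNIV - {0} = (\<lambda>i. g ^ i) ` {..<m}"
  proof -
    have "x \<in> (\<lambda>i. g ^ i) ` {..<m}" if "x \<in> UNIV - {0}" for x
    proof -
      from that gen obtain i where "x = g ^ i" by auto
      then show ?thesis using red[of i] m(1) by auto
    qed
    then show ?thesis using g by auto
  qed
  have "card ((\<lambda>i. g ^ i) ` {..<m}) = m"
    using inj by (subst card_image) (auto simp: inj_on_def)
  then have mn: "m = n" using img card_nz by simp
  show thesis
  proof
    show "g \<noteq> 0" by fact
    show "g ^ i = g ^ j \<longleftrightarrow> [i = j] (mod CARD('a) - 1)" for i j
      using inj[of "i mod m" "j mod m"] red[of i] red[of j] m(1) unfolding mn n_def[symmetric] cong_def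
      by (metis mod_less_divisor)
    show "\<exists>i<CARD('a) - 1. x = g ^ i" if "x \<noteq> 0" for x
      using that img unfolding mn n_def[symmetric] by auto
  qed
qed

lemma finite_field_power_card:
  assumes "finite (UNIV :: 'a::field set)" and "x \<noteq> (0 :: 'a)"
  shows "x ^ (CARD('a) - 1) = 1"
proof -
  obtain g :: 'a where g: "\<And>i j. g ^ i = g ^ j \<longleftrightarrow> [i = j] (mod CARD('a) - 1)"
      "\<And>x. x \<noteq> 0 \<Longrightarrow> \<exists>i<CARD('a) - 1. x = g ^ i"
    using finite_field_generator[OF assms(1)] by metis
  obtain i where "x = g ^ i" using g(2) assms(2) by blast
  moreover have "g ^ (i * (CARD('a) - 1)) = g ^ 0"
    by (subst g(1)) (simp add: cong_def)
  ultimately show ?thesis by (simp add: power_mult)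
qed

text \<open>Nonsquares are odd powers of a generator, and the sum of two odd exponents is
  even.\<close>

lemma nonsquare_mult_nonsquare:
  fixes a b :: "'a::field"
  assumes fin: "finite (UNIV :: 'a set)"
    and a: "\<nexists>x. x\<^sup>2 = a" and b: "\<nexists>x. x\<^sup>2 = b"
  shows "\<exists>x. x\<^sup>2 = a * b"
proof -
  obtain g :: 'a where g: "\<And>x. x \<noteq> 0 \<Longrightarrow> \<exists>i<CARD('a) - 1. x = g ^ i"
    using finite_field_generator[OF fin] by metis
  have odd_exp: "\<exists>i. c = g ^ (2 * i + 1)" if c: "\<nexists>x. x\<^sup>2 = c" for c
  proof -
    have "c \<noteq> 0" using c[simplified] by (metis zero_power2)
    then obtain i where i: "c = g ^ i" using g by blast
    have "odd i"
    proof
      assume "even i"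
      then obtain j where "i = 2 * j" by blast
      then have "(g ^ j)\<^sup>2 = c" using i by (simp add: power_mult[symmetric] mult.commute)
      then show False using c by blast
    qed
    then show ?thesis using i by (metis oddE)
  qed
  obtain i j where "a = g ^ (2 * i + 1)" "b = g ^ (2 * j + 1)" using odd_exp a b by metis
  then have "(g ^ (i + j + 1))\<^sup>2 = a * b"
    by (simp add: power_add power_mult power2_eq_square power_mult_distrib mult_ac)
  then show ?thesis by blast
qed

text \<open>If q = 4 m + 3, raising a square root of -1 to the power q - 1 = 2 (2 m + 1) would give
  1 = -1. If q = 4 m + 1, the m-th power of a generator is a square root of -1.\<close>

lemma minus_one_square_iff:
  assumes fin: "finite (UNIV :: 'a::field set)" and "(2 :: 'a) \<noteq> 0" and odd: "odd CARD('a)"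
  shows "(\<exists>x::'a. x\<^sup>2 = -1) \<longleftrightarrow> CARD('a) mod 4 = 1"
proof
  assume "\<exists>x::'a. x\<^sup>2 = -1"
  then obtain x :: 'a where x: "x\<^sup>2 = -1" by blast
  then have "x \<noteq> 0" by auto
  show "CARD('a) mod 4 = 1"
  proof (rule ccontr)
    assume "CARD('a) mod 4 \<noteq> 1"
    with odd have "CARD('a) mod 4 = 3" by presburger
    then obtain m where "CARD('a) = 4 * m + 3" by (metis mult_div_mod_eq)
    then have "x ^ (4 * m + 2) = 1"
      using finite_field_power_card[OF fin \<open>x \<noteq> 0\<close>] by simp
    moreover have "x ^ (4 * m + 2) = (x\<^sup>2) ^ (2 * m) * x\<^sup>2"
    proof -
      have "x ^ (4 * m + 2) = x ^ (2 * (2 * m) + 2)" by simp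
      then show ?thesis by (simp only: power_add power_mult)
    qed
    ultimately have "(-1 :: 'a) = 1" by (simp add: x)
    then have "(2 :: 'a) = 0" by (metis add.left_inverse one_add_one)
    then show False using assms(2) by blast
  qed
next
  assume c: "CARD('a) mod 4 = 1"
  obtain g :: 'a where g: "\<And>i j. g ^ i = g ^ j \<longleftrightarrow> [i = j] (mod CARD('a) - 1)"
    using finite_field_generator[OF fin] by metis
  obtain m where m: "CARD('a) = 4 * m + 1" using c by (metis mult_div_mod_eq)
  have "card {0, 1 :: 'a} \<le> CARD('a)" using fin by (intro card_mono) auto
  \<comment> \<open>A field has at least two elements; with \<open>m = 0\<close> the power
    \<open>g ^ (2 * m)\<close> would be 1.\<close>
  then have "m > 0" using m by (cases m) auto
  have "g ^ (4 * m) = g ^ 0" by (subst g) (simp add: m cong_def)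
  moreover have "g ^ (2 * m) \<noteq> g ^ 0" using \<open>m > 0\<close> by (subst g) (simp add: m cong_def)
  ultimately have "(g ^ (2 * m) - 1) * (g ^ (2 * m) + 1) = 0" "g ^ (2 * m) \<noteq> 1"
    by (simp_all add: algebra_simps flip: power_add)
  then have "(g ^ m)\<^sup>2 = -1"
    by (simp add: eq_neg_iff_add_eq_0 mult.commute flip: power_mult)
  then show "\<exists>x::'a. x\<^sup>2 = -1" by blast
qed

text \<open>A square root \<open>x\<close> of -3 and a primitive cube root of unity \<open>w\<close>
  determine each other through \<open>x = 2 * w + 1\<close>, and the latter exists exactly when 3
  divides q - 1.\<close>

lemma minus_three_square_iff:
  assumes fin: "finite (UNIV :: 'a::field set)" and 2: "(2 :: 'a) \<noteq> 0" and 3: "(3 :: 'a) \<noteq> 0"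
    and "CARD('a) mod 3 \<noteq> 0"
  shows "(\<exists>x::'a. x\<^sup>2 = -3) \<longleftrightarrow> CARD('a) mod 3 = 1"
proof
  assume "\<exists>x::'a. x\<^sup>2 = -3"
  then obtain x :: 'a where x: "x\<^sup>2 = -3" by blast
  define w where "w = (x - 1) / 2"
  have w2: "2 * w = x - 1" using 2 by (simp add: w_def)
  \<comment> \<open>Multiplying by 4 avoids denominators: after substituting
    \<open>2 * w = x - 1\<close> the value is x^2 + 3.\<close>
  have "4 * (w\<^sup>2 + w + 1) = (2 * w)\<^sup>2 + 2 * (2 * w) + 4" by (simp add: power2_eq_square algebra_simps)
  also have "\<dots> = 0" unfolding w2 using x by (simp add: power2_eq_square algebra_simps)
  finally have "w\<^sup>2 + w + 1 = 0" using 2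
    by (metis mult_2_right mult_eq_0_iff numeral_Bit0)
  then have w: "w\<^sup>2 = - w - 1"
    using eq_neg_iff_add_eq_0[of "w\<^sup>2" "w + 1"] by (simp add: add.assoc)
  have w3: "w ^ 3 = 1"
  proof -
    have "w ^ 3 = w * w\<^sup>2" by (simp add: power3_eq_cube power2_eq_square)
    also have "\<dots> = - w\<^sup>2 - w" by (subst w) (simp add: algebra_simps power2_eq_square)
    also have "\<dots> = 1" by (simp add: w)
    finally show ?thesis .
  qed
  have "w \<noteq> 1" using w 3 by (auto simp: algebra_simps)
  have "w \<noteq> 0" using w3 by auto
  show "CARD('a) mod 3 = 1"
  proof (rule ccontr)
    assume "CARD('a) mod 3 \<noteq> 1"
    with assms(4) have "CARD('a) mod 3 = 2" by presburger
    then obtain m where "CARD('a) = 3 * m + 2" by (metis mult_div_mod_eq)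
    then have "w ^ (3 * m + 1) = 1"
      using finite_field_power_card[OF fin \<open>w \<noteq> 0\<close>] by simp
    then show False using w3 \<open>w \<noteq> 1\<close> by (simp add: power_add power_mult)
  qed
next
  assume c: "CARD('a) mod 3 = 1"
  obtain g :: 'a where g: "\<And>i j. g ^ i = g ^ j \<longleftrightarrow> [i = j] (mod CARD('a) - 1)"
    using finite_field_generator[OF fin] by metis
  obtain m where m: "CARD('a) = 3 * m + 1" using c by (metis mult_div_mod_eq)
  have "card {0, 1 :: 'a} \<le> CARD('a)" using fin by (intro card_mono) auto
  then have "m > 0" using m by (cases m) auto
  define w where "w = g ^ m"
  have "w ^ 3 = 1" "w \<noteq> 1"
  proof -
    have "g ^ (3 * m) = g ^ 0" by (subst g) (simp add: m cong_def)
    then show "w ^ 3 = 1" by (simp add: w_def mult.commute flip: power_mult)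
    have "g ^ m \<noteq> g ^ 0" using \<open>m > 0\<close> by (subst g) (simp add: m cong_def)
    then show "w \<noteq> 1" by (simp add: w_def)
  qed
  then have "(w - 1) * (w\<^sup>2 + w + 1) = 0"
    by (simp add: algebra_simps power3_eq_cube power2_eq_square)
  then have "w\<^sup>2 + w + 1 = 0" using \<open>w \<noteq> 1\<close> by simp
  then have w: "w\<^sup>2 = - w - 1"
    using eq_neg_iff_add_eq_0[of "w\<^sup>2" "w + 1"] by (simp add: add.assoc)
  have "(2 * w + 1)\<^sup>2 = 4 * w\<^sup>2 + 4 * w + 1" by (simp add: power2_eq_square algebra_simps)
  also have "\<dots> = -3" unfolding w by (simp add: algebra_simps)
  finally show "\<exists>x::'a. x\<^sup>2 = -3" by blast
qed

text \<open>Since 3 = (-1) (-3), it is a square iff -1 and -3 are both squares or both nonsquares.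
  By the two preceding criteria this means that q is 1 modulo 4 iff it is 1 modulo 3, which among 1,
  5, 7, 11 holds for 1 and 11 only.\<close>

lemma three_square_iff:
  assumes fin: "finite (UNIV :: 'a::field set)" and 2: "(2 :: 'a) \<noteq> 0" and 3: "(3 :: 'a) \<noteq> 0"
    and q: "CARD('a) mod 12 \<in> {1, 5, 7, 11}"
  shows "(\<exists>x::'a. x\<^sup>2 = 3) \<longleftrightarrow> CARD('a) mod 12 \<in> {1, 11}"
proof -
  let ?q = "CARD('a)"
  have "odd (?q mod 12)" "?q mod 12 mod 3 \<noteq> 0" using q by auto
  then have odd: "odd ?q" and mod3: "?q mod 3 \<noteq> 0" by (simp_all add: dvd_mod_iff mod_mod_cancel)
  have sq_mult: "\<exists>x::'a. x\<^sup>2 = a * b" if "\<exists>x. x\<^sup>2 = a" "\<exists>x. x\<^sup>2 = b" for a b :: 'a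
    using that by (metis power_mult_distrib)
  have sq_mult': "\<exists>x::'a. x\<^sup>2 = b" if "\<exists>x. x\<^sup>2 = a" "\<exists>x. x\<^sup>2 = a * b" "a \<noteq> 0" for a b :: 'a
  proof -
    from that obtain x y where "x\<^sup>2 = a" "y\<^sup>2 = a * b" by blast
    then have "(y / x)\<^sup>2 = b" using \<open>a \<noteq> 0\<close> by (simp add: power_divide)
    then show ?thesis by blast
  qed
  have "(\<exists>x::'a. x\<^sup>2 = 3) \<longleftrightarrow> ((\<exists>x::'a. x\<^sup>2 = -1) \<longleftrightarrow> (\<exists>x::'a. x\<^sup>2 = -3))"
  proof (cases "\<exists>x::'a. x\<^sup>2 = -1")
    case True
    then show ?thesis using sq_mult'[of "-1" 3] sq_mult[of "-1" 3] by auto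
  next
    case False
    have "\<nexists>x::'a. x\<^sup>2 = 3" if "\<exists>x::'a. x\<^sup>2 = -3"
      using False that sq_mult'[of "-3" "-1"] 3 by auto
    then show ?thesis using False nonsquare_mult_nonsquare[OF fin, of "-1" "-3"] by auto
  qed
  also have "\<dots> \<longleftrightarrow> (?q mod 4 = 1 \<longleftrightarrow> ?q mod 3 = 1)"
    using minus_one_square_iff[OF fin 2 odd] minus_three_square_iff[OF fin 2 3 mod3] by simp
  also have "\<dots> \<longleftrightarrow> ?q mod 12 \<in> {1, 11}"
  proof -
    have "?q mod 4 = ?q mod 12 mod 4" "?q mod 3 = ?q mod 12 mod 3" by (simp_all add: mod_mod_cancel)
    then show ?thesis using q by auto
  qed
  finally show ?thesis .
qed

text \<open>Some natural number is the successor of a square in the field without being a square itself, since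
  \<open>-1\<close> is a natural number there; its negative is then a square.\<close>

lemma minus_one_sum_two_squares:
  assumes fin: "finite (UNIV :: 'a::field set)"
  shows "\<exists>u v :: 'a. u\<^sup>2 + v\<^sup>2 = -1"
proof (cases "\<exists>x::'a. x\<^sup>2 = -1")
  case True
  then obtain x :: 'a where "x\<^sup>2 + 0\<^sup>2 = -1" by auto
  then show ?thesis by blast
next
  case False
  have "CHAR('a) > 0" using fin finite_imp_CHAR_pos by blast
  then have "of_nat (CHAR('a) - 1) = (-1 :: 'a)" by (simp add: of_nat_diff)
  then have "\<exists>n. \<nexists>x::'a. x\<^sup>2 = of_nat n" using False by metis
  then obtain n where n: "\<nexists>x::'a. x\<^sup>2 = of_nat n" and min: "\<And>k. k < n \<Longrightarrow> \<exists>x::'a. x\<^sup>2 = of_nat k"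
    using exists_least_iff[of "\<lambda>n. \<nexists>x::'a. x\<^sup>2 = of_nat n"] by blast
  have "n \<noteq> 0" using n by (metis of_nat_0 zero_power2)
  then obtain u :: 'a where u: "u\<^sup>2 = of_nat (n - 1)" using min[of "n - 1"] by auto
  obtain v :: 'a where v: "v\<^sup>2 = -1 * of_nat n"
    using nonsquare_mult_nonsquare[OF fin False n] by blast
  have "u\<^sup>2 + v\<^sup>2 = -1" using u v \<open>n \<noteq> 0\<close> by (simp add: of_nat_diff)
  then show ?thesis by blast
qed

section \<open>Quadratic extensions of finite fields\<close>

lemma card_field_extension_of_degree_2:
  fixes \<iota> :: "'f::{field, finite} \<Rightarrow> 'e::field"
  assumes "field_extension_of_degree 2 \<iota>"
  shows "finite (UNIV :: 'e set)" and "CARD('e) = CARD('f)\<^sup>2"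
proof -
  from assms have "field_hom \<iota>" and dim: "vector_space.dim (\<lambda>c v. \<iota> c * v) (UNIV :: 'e set) = 2"
    by (auto simp: field_extension_of_degree_def)
  interpret field_hom \<iota> by fact
  interpret V: vector_space "\<lambda>c v. \<iota> c * v"
    by unfold_locales (auto simp: algebra_simps hom_add hom_mult)
  obtain B where B: "V.independent B" "V.span B = UNIV" "card B = 2"
    using V.basis_exists[of UNIV] dim by (metis UNIV_I subset_UNIV top.extremum_uniqueI)
  then obtain b c where bc: "B = {b, c}" "b \<noteq> c" by (meson card_2_iff)
  \<comment> \<open>Coordinates with respect to the basis \<open>{b, c}\<close>; bijectivity of
    \<open>h\<close> yields finiteness and the cardinality at once.\<close>
  define h where "h = (\<lambda>(x, y). \<iota> x * b + \<iota> y * c)"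
  have "inj h"
  proof (rule injI)
    fix p p' assume eq: "h p = h p'"
    define u where "u = (\<lambda>v. if v = b then fst p - fst p' else snd p - snd p')"
    have "(\<Sum>v\<in>B. \<iota> (u v) * v) = 0"
      using eq bc by (auto simp: u_def h_def case_prod_unfold hom_minus algebra_simps)
    then have "u v = 0" if "v \<in> B" for v
      using V.independentD[OF B(1) _ subset_refl _ that, of u] card_ge_0_finite[of B] B(3) by simp
    from this[of b] this[of c] show "p = p'" using bc by (auto simp: u_def prod_eq_iff split: if_splits)
  qed
  moreover have "range h = UNIV"
  proof -
    have "z \<in> range h" for z
    proof -
      have "z \<in> range (\<lambda>u. \<Sum>v\<in>B. \<iota> (u v) * v)"
        using V.span_finite[of B] B(2) bc by auto
      then obtain u where "z = \<iota> (u b) * b + \<iota> (u c) * c" using bc by auto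
      then have "z = h (u b, u c)" by (simp add: h_def)
      then show ?thesis by blast
    qed
    then show ?thesis by blast
  qed
  ultimately have bij: "bij_betw h UNIV UNIV" by (simp add: bij_betw_def)
  then show "finite (UNIV :: 'e set)" using bij_betw_finite[OF bij] by simp
  show "CARD('e) = CARD('f)\<^sup>2"
    using bij_betw_same_card[OF bij] by (simp add: power2_eq_square)
qed

text \<open>An element of the base field, as a power of a generator of the multiplicative group of the
  extension, has an exponent divisible by \<open>q + 1\<close>.\<close>

lemma square_in_quadratic_extension:
  fixes \<iota> :: "'f::{field, finite} \<Rightarrow> 'e::field"
  assumes ext: "field_extension_of_degree 2 \<iota>" and odd: "odd CARD('f)"
  shows "\<exists>s. s\<^sup>2 = \<iota> c"
proof (cases "c = 0")
  case True
  interpret field_hom \<iota> using ext by (simp add: field_extension_of_degree_def)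
  show ?thesis using True by (intro exI[of _ 0]) simp
next
  case False
  interpret field_hom \<iota> using ext by (simp add: field_extension_of_degree_def)
  note fin = card_field_extension_of_degree_2(1)[OF ext]
  define q where "q = CARD('f)"
  have q: "q > 0" unfolding q_def by simp
  obtain g :: 'e where g: "\<And>i j. g ^ i = g ^ j \<longleftrightarrow> [i = j] (mod CARD('e) - 1)"
      "\<And>x. x \<noteq> 0 \<Longrightarrow> \<exists>i<CARD('e) - 1. x = g ^ i"
    using finite_field_generator[OF fin] by metis
  have "\<iota> c \<noteq> 0" using False by simp
  then obtain i where i: "\<iota> c = g ^ i" using g(2) by blast
  have "c ^ (q - 1) = 1" using False unfolding q_def by (intro finite_field_power_card) auto
  then have "\<iota> c ^ (q - 1) = 1" by (metis hom_one hom_power)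
  then have "g ^ (i * (q - 1)) = g ^ 0" by (simp add: i power_mult)
  moreover have "CARD('e) - 1 = (q - 1) * (q + 1)"
    using card_field_extension_of_degree_2(2)[OF ext] q
    by (simp add: q_def[symmetric] power2_eq_square algebra_simps)
  ultimately have "(q - 1) * (q + 1) dvd i * (q - 1)"
    by (subst (asm) g(1)) (simp add: cong_0_iff)
  moreover have "q - 1 > 0"
  proof -
    have "card {0, 1 :: 'f} \<le> q" unfolding q_def by (intro card_mono) auto
    then show ?thesis by simp
  qed
  ultimately have "q + 1 dvd i" by (metis dvd_times_left_cancel_iff mult.commute neq0_conv)
  \<comment> \<open>Since q is odd, the divisor \<open>q + 1\<close> of \<open>i\<close> is even, so
    \<open>i\<close> can be halved.\<close>
  then have "even i" using odd unfolding q_def by (meson dvd_trans even_plus_one_iff)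
  then obtain j where "i = 2 * j" by blast
  then have "(g ^ j)\<^sup>2 = \<iota> c" by (simp add: i mult.commute flip: power_mult)
  then show ?thesis by blast
qed

section \<open>Group presentations and normal forms\<close>

lemma (in group) word_eval_closed:
  assumes "range f \<subseteq> carrier G"
  shows "word_eval G f w \<in> carrier G"
  using assms by (induction w) auto

lemma (in group) word_eval_append:
  assumes "range f \<subseteq> carrier G"
  shows "word_eval G f (u @ v) = word_eval G f u \<otimes> word_eval G f v"
proof -
  have "f a \<in> carrier G" for a using assms by auto
  then show ?thesis using word_eval_closed[OF assms] by (induction u) (simp_all add: m_assoc)
qed

lemma (in group) word_cong_imp_word_eval_eq:
  assumes f: "range f \<subseteq> carrier G"
    and R: "\<And>l r. (l, r) \<in> R \<Longrightarrow> word_eval G f l = word_eval G f r"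
    and "word_cong R u v"
  shows "word_eval G f u = word_eval G f v"
  using assms(3)
proof induction
  case (cancel u a b v)
  have "f a \<in> carrier G" using f by auto
  then have "word_eval G f [(a, b), (a, \<not> b)] = \<one>" by simp
  then show ?case
    using word_eval_append[OF f] word_eval_closed[OF f] by (metis append.assoc l_one)
next
  case (relation l r u v)
  then show ?case using R word_eval_append[OF f] by simp
qed auto

lemma (in group) word_eval_generate:
  assumes f: "range f \<subseteq> carrier G" and "g \<in> generate G (range f)"
  shows "\<exists>w. g = word_eval G f w"
  using assms(2)
proof induction
  case one
  show ?case by (rule exI[of _ "[]"]) simp
next
  case (incl h)
  then obtain a where "h = f a" by blast
  moreover have "f a \<in> carrier G" using f by auto
  ultimately show ?case by (intro exI[of _ "[(a, True)]"]) simp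
next
  case (inv h)
  then obtain a where "h = f a" by blast
  moreover have "f a \<in> carrier G" using f by auto
  ultimately show ?case by (intro exI[of _ "[(a, False)]"]) simp
next
  case (eng h1 h2)
  then show ?case using word_eval_append[OF f] by metis
qed

text \<open>A group element is sent to the value in \<open>H\<close> of some word representing it.
  The choice of word does not matter: words with equal values in \<open>G\<close> are congruent, and
  congruent words have equal values in \<open>H\<close>.\<close>

lemma presented_by_hom_exists:
  assumes pres: "presented_by G f R" and "Group.group H"
    and h: "range h \<subseteq> carrier H"
    and R: "\<And>l r. (l, r) \<in> R \<Longrightarrow> word_eval H h l = word_eval H h r"
  obtains \<phi> where "\<phi> \<in> hom G H" "\<And>a. \<phi> (f a) = h a"
proof -
  interpret G: Group.group G using pres by (simp add: presented_by_def)
  interpret H: Group.group H by fact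
  have f: "range f \<subseteq> carrier G" and cong: "\<And>u v. word_eval G f u = word_eval G f v \<longleftrightarrow> word_cong R u v"
    using pres by (auto simp: presented_by_def)
  define \<phi> where "\<phi> = (\<lambda>g. word_eval H h (SOME w. g = word_eval G f w))"
  have \<phi>: "\<phi> (word_eval G f w) = word_eval H h w" for w
  proof -
    have "word_eval G f w = word_eval G f (SOME w'. word_eval G f w = word_eval G f w')"
      by (rule someI[of _ w]) (rule HOL.refl)
    then have "word_cong R w (SOME w'. word_eval G f w = word_eval G f w')"
      by (simp only: cong)
    then show ?thesis
      unfolding \<phi>_def using H.word_cong_imp_word_eval_eq[OF h R] by metis
  qed
  have surj: "\<exists>w. g = word_eval G f w" if "g \<in> carrier G" for g
    using G.word_eval_generate[OF f] that pres by (simp add: presented_by_def)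
  show thesis
  proof
    show "\<phi> \<in> hom G H"
    proof (rule homI)
      fix g assume "g \<in> carrier G"
      then obtain w where "g = word_eval G f w" using surj by blast
      then show "\<phi> g \<in> carrier H" using \<phi> H.word_eval_closed[OF h] by simp
      fix g' assume "g' \<in> carrier G"
      then obtain w' where "g' = word_eval G f w'" using surj by blast
      with \<open>g = _\<close> show "\<phi> (g \<otimes>\<^bsub>G\<^esub> g') = \<phi> g \<otimes>\<^bsub>H\<^esub> \<phi> g'"
        using \<phi> G.word_eval_append[OF f] H.word_eval_append[OF h] by metis
    qed
    fix a
    have "f a = word_eval G f [(a, True)]" "h a = word_eval H h [(a, True)]"
      using f h by (auto simp: image_subset_iff)
    then show "\<phi> (f a) = h a" using \<phi> by metis
  qed
qed

lemma (in group) word_eval_replicate: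
  assumes "f a \<in> carrier G"
  shows "word_eval G f (replicate n (a, True)) = f a [^] n"
  using assms by (induction n) (auto simp: nat_pow_Suc2[symmetric] simp del: nat_pow_Suc)

section \<open>Normal forms in the presented group\<close>

locale C3_Q8 = Group.group G for G (structure) +
  fixes f :: "xy \<Rightarrow> 'a"
  assumes presented: "presented_by G f C3_Q8_relations"
begin

abbreviation "x \<equiv> f gen_x"
abbreviation "y \<equiv> f gen_y"

lemma range_gen: "range f \<subseteq> carrier G"
  using presented by (simp add: presented_by_def)

lemma gen_closed [simp]: "f a \<in> carrier G"
  using range_gen by auto

lemma relation_eq: "(l, r) \<in> C3_Q8_relations \<Longrightarrow> word_eval G f l = word_eval G f r"
  using presented word_cong.relation[of l r C3_Q8_relations "[]" "[]"] by (simp add: presented_by_def)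

lemma x_pow_12: "x [^] (12::nat) = \<one>"
  using relation_eq[of "replicate 12 (gen_x, True)" "[]"]
  by (simp only: word_eval_replicate gen_closed) (simp add: C3_Q8_relations_def)

lemma y_pow_2: "y [^] (2::nat) = x [^] (6::nat)"
  using relation_eq[of "replicate 6 (gen_x, True)" "replicate 2 (gen_y, True)"]
  by (simp only: word_eval_replicate gen_closed) (simp add: C3_Q8_relations_def)

lemma y_x: "y \<otimes> x = inv x \<otimes> y"
proof -
  have "y \<otimes> (x \<otimes> inv y) = inv x"
    using relation_eq[of "[(gen_y, True), (gen_x, True), (gen_y, False)]" "[(gen_x, False)]"]
    by (simp add: C3_Q8_relations_def)
  then have "inv x \<otimes> y = y \<otimes> (x \<otimes> inv y) \<otimes> y" by simp
  then show ?thesis by (simp add: m_assoc)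
qed

lemma inv_x: "inv x = x [^] (11::nat)"
proof (rule inv_equality)
  show "x [^] (11::nat) \<otimes> x = \<one>" using x_pow_12 nat_pow_Suc[of x 11] by simp
qed auto

text \<open>As the 12th power of \<open>x\<close> is 1, the exponent \<open>11 * i\<close> serves as
  -i, and all exponents stay natural numbers.\<close>

lemma y_x_pow: "y \<otimes> x [^] (i::nat) = x [^] (11 * i) \<otimes> y"
proof (induction i)
  case (Suc i)
  have "y \<otimes> x [^] Suc i = x [^] (11 * i) \<otimes> (y \<otimes> x)"
    using Suc by (simp add: m_assoc[symmetric])
  also have "\<dots> = x [^] (11 * Suc i) \<otimes> y"
    by (simp add: y_x inv_x m_assoc[symmetric] nat_pow_mult add.commute)
  finally show ?case .
qed simp

lemma inv_y: "inv y = x [^] (6::nat) \<otimes> y"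
proof (rule inv_equality)
  have "x [^] (6::nat) \<otimes> y \<otimes> y = x [^] (6::nat) \<otimes> y [^] (2::nat)"
    by (simp add: m_assoc numeral_2_eq_2)
  then show "x [^] (6::nat) \<otimes> y \<otimes> y = \<one>"
    using x_pow_12 by (simp add: y_pow_2 nat_pow_mult)
qed auto

lemma x_pow_mod: "x [^] (i::nat) = x [^] (i mod 12)"
proof -
  have "x [^] i = x [^] (12 * (i div 12) + i mod 12)" by simp
  also have "\<dots> = x [^] (i mod 12)"
    by (simp only: nat_pow_mult[symmetric] nat_pow_pow[symmetric] gen_closed x_pow_12 nat_pow_one) simp
  finally show ?thesis .
qed

text \<open>Letters are added on the left one at a time: \<open>y\<close> passes the collected power
  of \<open>x\<close> by \<open>y_x_pow\<close>, and inverse letters are rewritten by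
  \<open>inv_x\<close> and \<open>inv_y\<close>. The bounds on the exponents are imposed only at the
  end.\<close>

lemma carrier_normal_form:
  assumes "g \<in> carrier G"
  obtains i e :: nat where "g = x [^] i \<otimes> y [^] e" "i < 12" "e < 2"
proof -
  have "\<exists>(i::nat) (e::nat). word_eval G f w = x [^] i \<otimes> y [^] e" for w
  proof (induction w)
    case Nil
    show ?case by (intro exI[of _ 0]) simp
  next
    case (Cons s w)
    then obtain i e :: nat where w: "word_eval G f w = x [^] i \<otimes> y [^] e" by blast
    have X: "x [^] k \<otimes> word_eval G f w = x [^] (k + i) \<otimes> y [^] e" for k :: nat
      by (simp add: w m_assoc[symmetric] nat_pow_mult)
    have "y \<otimes> word_eval G f w = x [^] (11 * i) \<otimes> (y \<otimes> y [^] e)"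
      by (simp add: w m_assoc[symmetric] y_x_pow)
    also have "\<dots> = x [^] (11 * i) \<otimes> y [^] Suc e"
      by (simp only: nat_pow_Suc2 gen_closed)
    finally have Y: "y \<otimes> word_eval G f w = x [^] (11 * i) \<otimes> y [^] Suc e" .
    have Y': "inv y \<otimes> word_eval G f w = x [^] (6 + 11 * i) \<otimes> y [^] Suc e"
      using Y by (simp add: inv_y m_assoc word_eval_closed[OF range_gen] nat_pow_mult[symmetric])
    show ?case
      using X[of 1] X[of 11] Y Y'
      by (cases s; cases "fst s"; cases "snd s") (simp only: word_eval.simps fst_conv snd_conv inv_x nat_pow_eone gen_closed if_True if_False; blast)+
  qed
  then obtain i e :: nat where g: "g = x [^] i \<otimes> y [^] e"
    using word_eval_generate[OF range_gen] assms presented by (metis presented_by_def)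
  \<comment> \<open>Pairs of \<open>y\<close> are exchanged for \<open>x [^] 6\<close>, which leaves
    at most one \<open>y\<close>; the exponent of \<open>x\<close> is then reduced modulo
    12.\<close>
  have "y [^] e = y [^] (2 * (e div 2) + e mod 2)" by simp
  also have "\<dots> = x [^] (6 * (e div 2)) \<otimes> y [^] (e mod 2)"
    by (simp only: nat_pow_mult[symmetric] nat_pow_pow[symmetric] gen_closed y_pow_2)
  finally have "g = x [^] (i + 6 * (e div 2)) \<otimes> y [^] (e mod 2)"
    by (simp add: g m_assoc[symmetric] nat_pow_mult)
  then show thesis using that[of "(i + 6 * (e div 2)) mod 12" "e mod 2"] x_pow_mod by simp
qed

text \<open>The third relation enters as X Y X = Y, free of inverses, so that for explicit matrices
  it is checked by multiplication alone.\<close>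

lemma hom_exists:
  assumes "Group.group H" and X: "X \<in> carrier H" and Y: "Y \<in> carrier H"
    and "X [^]\<^bsub>H\<^esub> (12::nat) = \<one>\<^bsub>H\<^esub>"
    and "X [^]\<^bsub>H\<^esub> (6::nat) = Y \<otimes>\<^bsub>H\<^esub> Y"
    and "X \<otimes>\<^bsub>H\<^esub> Y \<otimes>\<^bsub>H\<^esub> X = Y"
  obtains \<phi> where "\<phi> \<in> hom G H" "\<phi> x = X" "\<phi> y = Y"
proof -
  interpret H: Group.group H by fact
  define h where "h = case_xy X Y"
  have h: "range h \<subseteq> carrier H" using X Y by (auto simp: h_def split: xy.split)
  have hx: "h gen_x = X" and hy: "h gen_y = Y" by (simp_all add: h_def)
  have "Y \<otimes>\<^bsub>H\<^esub> X = inv\<^bsub>H\<^esub> X \<otimes>\<^bsub>H\<^esub> Y"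
    using assms(6) X Y by (metis H.inv_solve_left H.m_assoc H.m_closed)
  then have rel3: "Y \<otimes>\<^bsub>H\<^esub> (X \<otimes>\<^bsub>H\<^esub> inv\<^bsub>H\<^esub> Y) = inv\<^bsub>H\<^esub> X"
    using X Y by (metis H.inv_closed H.m_assoc H.r_inv H.r_one)
  have "word_eval H h l = word_eval H h r" if rel: "(l, r) \<in> C3_Q8_relations" for l r
  proof -
    consider "l = replicate 12 (gen_x, True)" "r = []"
      | "l = replicate 6 (gen_x, True)" "r = replicate 2 (gen_y, True)"
      | "l = [(gen_y, True), (gen_x, True), (gen_y, False)]" "r = [(gen_x, False)]"
      using rel by (auto simp only: C3_Q8_relations_def insert_iff empty_iff prod.inject)
    then show ?thesis
    proof cases
      case 1
      then show ?thesis using X assms(4) H.word_eval_replicate[of h gen_x 12] by (simp only: hx) simp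
    next
      case 2
      then show ?thesis
        using X Y assms(5) H.word_eval_replicate[of h gen_x 6] H.word_eval_replicate[of h gen_y 2]
        by (simp only: hx hy) (simp add: numeral_2_eq_2)
    next
      case 3
      then show ?thesis using X Y rel3 by (simp add: hx hy)
    qed
  qed
  from presented_by_hom_exists[OF presented assms(1) h this]
  obtain \<phi> where "\<phi> \<in> hom G H" "\<And>a. \<phi> (f a) = h a" by metis
  then show thesis using that[of \<phi>] hx hy by simp
qed

end

section \<open>Representations and their extension to the group algebra\<close>

definition mat2 :: "'a \<Rightarrow> 'a \<Rightarrow> 'a \<Rightarrow> 'a \<Rightarrow> 'a mat" where
  "mat2 a b c d = mat 2 2 (\<lambda>(i, j). if i = 0 then if j = 0 then a else b else if j = 0 then c else d)"

lemma mat2_carrier [simp]: "mat2 a b c d \<in> carrier_mat 2 2"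
  by (simp add: mat2_def)

lemma mat2_mult [simp]:
  "mat2 a b c d * mat2 a' b' c' d' =
     mat2 (a * a' + b * c') (a * b' + b * d') (c * a' + d * c') (c * b' + d * d' :: 'a::semiring_1)"
  by (rule eq_matI) (auto simp: mat2_def scalar_prod_def less_2_cases_iff numeral_2_eq_2)

lemma one_mat_2: "1\<^sub>m 2 = mat2 1 0 0 (1 :: 'a::semiring_1)"
  by (rule eq_matI) (auto simp: mat2_def less_2_cases_iff)

definition mat1 :: "'a \<Rightarrow> 'a mat" where
  "mat1 a = mat 1 1 (\<lambda>_. a)"

lemma mat1_carrier [simp]: "mat1 a \<in> carrier_mat 1 1" "mat1 a \<in> carrier_mat (Suc 0) (Suc 0)"
  by (simp_all add: mat1_def)

lemma mat1_mult [simp]: "mat1 a * mat1 b = mat1 (a * b :: 'a::semiring_1)"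
  by (rule eq_matI) (auto simp: mat1_def scalar_prod_def)

lemma one_mat_1:
  "1\<^sub>m 1 = mat1 (1 :: 'a::semiring_1)" "1\<^sub>m (Suc 0) = mat1 (1 :: 'a::semiring_1)"
  by (auto simp: mat1_def intro!: eq_matI)

lemma mat1_inject [simp]: "mat1 a = mat1 b \<longleftrightarrow> a = b"
proof
  assume "mat1 a = mat1 b"
  then have "mat1 a $$ (0, 0) = mat1 b $$ (0, 0)" by simp
  then show "a = b" by (simp add: mat1_def)
qed simp

lemma carrier_mat_1_eq: "carrier_mat 1 1 = range mat1"
proof -
  have "A = mat1 (A $$ (0, 0))" if "A \<in> carrier_mat 1 1" for A :: "'a mat"
    using that by (intro eq_matI) (auto simp: mat1_def)
  then show ?thesis by auto
qed

definition mat_trace :: "'a::comm_monoid_add mat \<Rightarrow> 'a" where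
  "mat_trace A = (\<Sum>i<dim_row A. A $$ (i, i))"

lemma mat_trace_mat2 [simp]: "mat_trace (mat2 a b c d) = a + d"
  by (simp add: mat_trace_def mat2_def numeral_2_eq_2)

lemma mat_trace_mat1 [simp]: "mat_trace (mat1 a) = a"
  by (simp add: mat_trace_def mat1_def)

lemma mat_trace_mult:
  assumes "A \<in> carrier_mat n n" "B \<in> carrier_mat n n"
  shows "mat_trace (A * B) = (\<Sum>i<n. \<Sum>k<n. A $$ (i, k) * (B $$ (k, i) :: 'a::semiring_0))"
  using assms by (auto simp: mat_trace_def scalar_prod_def lessThan_atLeast0 intro!: sum.cong)

lemma GL_simps:
  "mult (GL n TYPE('a::field)) = (*)" "one (GL n TYPE('a)) = 1\<^sub>m n"
  "carrier (GL n TYPE('a)) = Units (ring_mat TYPE('a) n ())"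
  by (simp_all add: GL_def units_of_def ring_mat_def)

lemma monoid_ring_mat: "Group.monoid (ring_mat TYPE('a::field) n b)"
  using ring_mat[of n b, where 'a = 'a] by (simp add: ring_def)

lemma group_GL: "Group.group (GL n TYPE('a::field))"
  unfolding GL_def by (rule Group.monoid.units_group[OF monoid_ring_mat])

lemma GL_carrier_mat: "A \<in> carrier (GL n TYPE('a::field)) \<Longrightarrow> A \<in> carrier_mat n n"
  by (auto simp: GL_simps Units_def ring_mat_simps)

lemma GL_I:
  assumes "A \<in> carrier_mat n n" "B \<in> carrier_mat n n" "A * B = 1\<^sub>m n" "B * A = 1\<^sub>m n"
  shows "A \<in> carrier (GL n TYPE('a::field))"
  using assms by (auto simp: GL_simps Units_def ring_mat_simps)

text \<open>The Chebyshev recursion: \<open>X\<^sup>k = cheb t k X - cheb t (k - 1)\<close> for every root \<open>X\<close> of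
  \<open>z\<^sup>2 - t z + 1\<close>.\<close>

fun cheb :: "'a::comm_ring_1 \<Rightarrow> nat \<Rightarrow> 'a" where
  "cheb t 0 = 0"
| "cheb t (Suc 0) = 1"
| "cheb t (Suc (Suc n)) = t * cheb t (Suc n) - cheb t n"

text \<open>By Cayley-Hamilton the power is \<open>cheb t k\<close> times the matrix minus
  \<open>cheb t (k - 1)\<close> times the identity. The latter coefficient is expressed through
  \<open>cheb t (Suc k)\<close>, which is correct also at \<open>k = 0\<close>.\<close>

lemma rotation_pow:
  fixes t :: "'a::field"
  shows "mat2 0 (-1) 1 t [^]\<^bsub>GL 2 TYPE('a)\<^esub> k =
     mat2 (cheb t (Suc k) - t * cheb t k) (- cheb t k) (cheb t k) (cheb t (Suc k))"
  by (induction k) (simp_all add: GL_simps one_mat_2 algebra_simps)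

context C3_Q8
begin

text \<open>\<open>X\<close> is the companion matrix of \<open>z\<^sup>2 - t z + 1\<close>. The matrices inverting \<open>X\<close> by conjugation are
  \<open>S (a + b X)\<close>, where \<open>S\<close> swaps the two basis vectors, and the square of such a matrix is the scalar
  \<open>a\<^sup>2 + a b t + b\<^sup>2\<close>.\<close>

lemma two_dim_rep_exists:
  fixes t a b \<epsilon> :: "'e::field"
  assumes "cheb t 6 = 0" "cheb t 5 = - \<epsilon>" "\<epsilon>\<^sup>2 = 1" "a\<^sup>2 + a * b * t + b\<^sup>2 = \<epsilon>"
  obtains \<phi> where "\<phi> \<in> hom G (GL 2 TYPE('e))"
    "\<And>i. mat_trace (\<phi> (x [^] (i::nat) \<otimes> y [^] (0::nat))) = 2 * cheb t (Suc i) - t * cheb t i"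
    "\<And>i. mat_trace (\<phi> (x [^] (i::nat) \<otimes> y [^] (1::nat))) = 0"
proof -
  interpret H: Group.group "GL 2 TYPE('e)" by (rule group_GL)
  define X where "X = mat2 0 (-1) 1 t"
  define Y where "Y = mat2 b (a + b * t) a (- b)"
  have YY: "Y * Y = mat2 \<epsilon> 0 0 \<epsilon>"
    using assms(4) by (simp add: Y_def power2_eq_square algebra_simps)
  have X: "X \<in> carrier (GL 2 TYPE('e))"
    by (rule GL_I[of _ _ "mat2 t 1 (-1) 0"]) (simp_all add: X_def one_mat_2)
  have Y: "Y \<in> carrier (GL 2 TYPE('e))"
  proof (rule GL_I)
    \<comment> \<open>\<open>Y * Y\<close> is the scalar \<epsilon>, whose square is 1, so the
      inverse of \<open>Y\<close> is \<epsilon> times \<open>Y\<close>.\<close>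
    show "Y * mat2 (\<epsilon> * b) (\<epsilon> * (a + b * t)) (\<epsilon> * a) (- (\<epsilon> * b)) = 1\<^sub>m 2"
      "mat2 (\<epsilon> * b) (\<epsilon> * (a + b * t)) (\<epsilon> * a) (- (\<epsilon> * b)) * Y = 1\<^sub>m 2"
      using assms(3) unfolding assms(4)[symmetric]
      by (simp_all add: Y_def one_mat_2 power2_eq_square algebra_simps)
  qed (simp_all add: Y_def)
  \<comment> \<open>The two hypotheses on \<open>cheb\<close> say that the sixth power of
    \<open>X\<close> is the scalar \<epsilon>, in agreement with \<open>Y * Y\<close>.\<close>
  have X6: "X [^]\<^bsub>GL 2 TYPE('e)\<^esub> (6::nat) = mat2 \<epsilon> 0 0 \<epsilon>"
  proof -
    have "cheb t (Suc 6) = t * cheb t 6 - cheb t 5" by (simp add: numeral_eq_Suc)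
    then show ?thesis unfolding X_def rotation_pow using assms(1,2) by simp
  qed
  have "X [^]\<^bsub>GL 2 TYPE('e)\<^esub> (12::nat) = X [^]\<^bsub>GL 2 TYPE('e)\<^esub> (6::nat) \<otimes>\<^bsub>GL 2 TYPE('e)\<^esub> X [^]\<^bsub>GL 2 TYPE('e)\<^esub> (6::nat)"
    using X by (simp add: H.nat_pow_mult)
  also have "\<dots> = \<one>\<^bsub>GL 2 TYPE('e)\<^esub>"
    using assms(3) by (simp add: X6 GL_simps one_mat_2 power2_eq_square)
  finally have X12: "X [^]\<^bsub>GL 2 TYPE('e)\<^esub> (12::nat) = \<one>\<^bsub>GL 2 TYPE('e)\<^esub>" .
  have "X \<otimes>\<^bsub>GL 2 TYPE('e)\<^esub> Y \<otimes>\<^bsub>GL 2 TYPE('e)\<^esub> X = Y"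
    by (simp add: GL_simps X_def Y_def algebra_simps)
  with X6 YY obtain \<phi> where \<phi>: "\<phi> \<in> hom G (GL 2 TYPE('e))" "\<phi> x = X" "\<phi> y = Y"
    using hom_exists[OF group_GL X Y X12] by (metis GL_simps(1))
  have pow: "\<phi> (g [^] (i::nat)) = \<phi> g [^]\<^bsub>GL 2 TYPE('e)\<^esub> i" if "g \<in> carrier G" for g i
    using \<phi>(1) that by (intro group_hom.hom_nat_pow) (auto simp: group_hom_def group_hom_axioms_def is_group group_GL)
  show thesis
  proof
    fix i :: nat
    have *: "\<phi> (x [^] i \<otimes> y [^] e) = X [^]\<^bsub>GL 2 TYPE('e)\<^esub> i * Y [^]\<^bsub>GL 2 TYPE('e)\<^esub> e" for e :: nat
      using \<phi> by (simp add: hom_mult[OF \<phi>(1)] pow GL_simps)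
    have "\<phi> (x [^] i \<otimes> y [^] (0::nat)) = X [^]\<^bsub>GL 2 TYPE('e)\<^esub> i"
      unfolding * unfolding X_def rotation_pow by (simp add: GL_simps one_mat_2)
    then show "mat_trace (\<phi> (x [^] i \<otimes> y [^] (0::nat))) = 2 * cheb t (Suc i) - t * cheb t i"
      unfolding X_def rotation_pow by simp
    have "\<phi> (x [^] i \<otimes> y [^] (1::nat)) = X [^]\<^bsub>GL 2 TYPE('e)\<^esub> i * Y"
      unfolding * using Y by (simp add: H.nat_pow_eone)
    then show "mat_trace (\<phi> (x [^] i \<otimes> y [^] (1::nat))) = 0"
      unfolding X_def rotation_pow Y_def by (simp add: algebra_simps)
  qed (fact \<phi>(1))
qed

text \<open>Over a field the relation x y x = y forces the image of \<open>x\<close> to square to 1,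
  and then that of \<open>y\<close> does too; so pairs of signs give all linear characters.\<close>

lemma one_dim_rep_exists:
  fixes a b :: "'e::field"
  assumes "a\<^sup>2 = 1" "b\<^sup>2 = 1"
  obtains \<phi> where "\<phi> \<in> hom G (GL 1 TYPE('e))"
    "\<And>i e. mat_trace (\<phi> (x [^] (i::nat) \<otimes> y [^] (e::nat))) = a ^ i * b ^ e"
proof -
  interpret H: Group.group "GL 1 TYPE('e)" by (rule group_GL)
  have in_GL: "mat1 c \<in> carrier (GL 1 TYPE('e))" if "c\<^sup>2 = 1" for c :: 'e
    using that by (intro GL_I[of _ _ "mat1 c"]) (simp_all add: one_mat_1 power2_eq_square)
  have pow1: "mat1 c [^]\<^bsub>GL 1 TYPE('e)\<^esub> (i::nat) = mat1 (c ^ i)" for c i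
    by (induction i) (simp_all add: GL_simps one_mat_1 mult.commute)
  have "a ^ 6 = (a\<^sup>2) ^ 3" "a ^ 12 = (a\<^sup>2) ^ 6" by (simp_all flip: power_mult)
  then have a: "a ^ 6 = 1" "a ^ 12 = 1" by (simp_all add: assms)
  have "b * b = 1" "a * b * a = b" using assms by (simp_all add: power2_eq_square mult_ac)
  then obtain \<phi> where \<phi>: "\<phi> \<in> hom G (GL 1 TYPE('e))" "\<phi> x = mat1 a" "\<phi> y = mat1 b"
    using hom_exists[OF group_GL in_GL[OF assms(1)] in_GL[OF assms(2)]] a
    unfolding pow1 unfolding GL_simps by (metis mat1_mult one_mat_1(1))
  have pow: "\<phi> (g [^] (i::nat)) = \<phi> g [^]\<^bsub>GL 1 TYPE('e)\<^esub> i" if "g \<in> carrier G" for g i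
    using \<phi>(1) that by (intro group_hom.hom_nat_pow) (auto simp: group_hom_def group_hom_axioms_def is_group group_GL)
  show thesis
  proof
    fix i e :: nat
    have "\<phi> (x [^] i \<otimes> y [^] e) = mat1 (a ^ i) * mat1 (b ^ e)"
      using \<phi> by (simp add: hom_mult[OF \<phi>(1)] pow GL_simps pow1[simplified])
    then show "mat_trace (\<phi> (x [^] i \<otimes> y [^] e)) = a ^ i * b ^ e" by simp
  qed (fact \<phi>(1))
qed

end

text \<open>Coefficients act on matrices over a possibly larger field through \<iota>. This treats
  the factor over the quadratic extension together with those over the base field, for which \<iota>
  is the identity.\<close>

definition alg_rep ::
    "('g, 'm) monoid_scheme \<Rightarrow> nat \<Rightarrow> ('f \<Rightarrow> 'e::field) \<Rightarrow> ('g \<Rightarrow> 'e mat) \<Rightarrow> ('g \<Rightarrow> 'f) \<Rightarrow> 'e mat" where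
  "alg_rep G n \<iota> \<phi> a = mat n n (\<lambda>ij. \<Sum>g\<in>carrier G. \<iota> (a g) * \<phi> g $$ ij)"

lemma alg_rep_carrier [simp]: "alg_rep G n \<iota> \<phi> a \<in> carrier_mat n n"
  by (simp add: alg_rep_def)

lemma alg_rep_one:
  fixes \<iota> :: "'f::field \<Rightarrow> 'e::field"
  assumes "Group.group G" "finite (carrier G)" "field_hom \<iota>" and \<phi>: "\<phi> \<in> hom G (GL n TYPE('e))"
  shows "alg_rep G n \<iota> \<phi> (one (group_algebra TYPE('f) G)) = 1\<^sub>m n"
proof (rule eq_matI)
  interpret Group.group G by fact
  interpret field_hom \<iota> by fact
  have \<phi>1: "\<phi> \<one>\<^bsub>G\<^esub> = 1\<^sub>m n"
    using Group.hom_one[OF \<phi> assms(1) group_GL] by (simp add: GL_simps)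
  fix i j assume "i < dim_row (1\<^sub>m n :: 'e mat)" "j < dim_col (1\<^sub>m n :: 'e mat)"
  moreover have "(\<Sum>g\<in>carrier G. \<iota> (if g = \<one>\<^bsub>G\<^esub> then 1 else 0) * \<phi> g $$ (i, j)) =
      (\<Sum>g\<in>carrier G. if g = \<one>\<^bsub>G\<^esub> then \<phi> g $$ (i, j) else 0)"
    by (intro sum.cong) auto
  ultimately show "alg_rep G n \<iota> \<phi> (one (group_algebra TYPE('f) G)) $$ (i, j) = (1\<^sub>m n :: 'e mat) $$ (i, j)"
    using assms(2) by (simp add: alg_rep_def group_algebra_def \<phi>1)
qed (simp_all add: alg_rep_def)

text \<open>Substituting g = h k in the convolution sum separates the variables, and
  multiplicativity of \<phi> turns the result into a matrix product.\<close>

lemma alg_rep_mult: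
  fixes \<iota> :: "'f::field \<Rightarrow> 'e::field"
  assumes "Group.group G" "finite (carrier G)" "field_hom \<iota>" and \<phi>: "\<phi> \<in> hom G (GL n TYPE('e))"
  shows "alg_rep G n \<iota> \<phi> (a \<otimes>\<^bsub>group_algebra TYPE('f) G\<^esub> b) = alg_rep G n \<iota> \<phi> a * alg_rep G n \<iota> \<phi> b"
proof (rule eq_matI)
  interpret Group.group G by fact
  interpret field_hom \<iota> by fact
  have \<phi>_mat: "\<phi> g \<in> carrier_mat n n" if "g \<in> carrier G" for g
    using that \<phi> by (intro GL_carrier_mat) (auto simp: hom_def)
  fix i j assume "i < dim_row (alg_rep G n \<iota> \<phi> a * alg_rep G n \<iota> \<phi> b)"
    "j < dim_col (alg_rep G n \<iota> \<phi> a * alg_rep G n \<iota> \<phi> b)"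
  then have ij: "i < n" "j < n" by (simp_all add: alg_rep_def)
  have \<phi>_mult: "\<phi> (h \<otimes>\<^bsub>G\<^esub> k) $$ (i, j) = (\<Sum>l<n. \<phi> h $$ (i, l) * \<phi> k $$ (l, j))"
    if "h \<in> carrier G" "k \<in> carrier G" for h k
    using that \<phi>_mat[of h] \<phi>_mat[of k] ij
    by (simp add: Group.hom_mult[OF \<phi>] GL_simps scalar_prod_def lessThan_atLeast0)
  have "alg_rep G n \<iota> \<phi> (a \<otimes>\<^bsub>group_algebra TYPE('f) G\<^esub> b) $$ (i, j) =
      (\<Sum>g\<in>carrier G. \<Sum>h\<in>carrier G. \<iota> (a h) * \<iota> (b (inv\<^bsub>G\<^esub> h \<otimes>\<^bsub>G\<^esub> g)) * \<phi> g $$ (i, j))"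
    using ij by (simp add: alg_rep_def group_algebra_def hom_sum hom_mult sum_distrib_right cong: sum.cong)
  also have "\<dots> = (\<Sum>h\<in>carrier G. \<Sum>g\<in>carrier G. \<iota> (a h) * \<iota> (b (inv\<^bsub>G\<^esub> h \<otimes>\<^bsub>G\<^esub> g)) * \<phi> g $$ (i, j))"
    by (rule sum.swap)
  also have "\<dots> = (\<Sum>h\<in>carrier G. \<Sum>k\<in>carrier G. \<iota> (a h) * \<iota> (b k) * \<phi> (h \<otimes>\<^bsub>G\<^esub> k) $$ (i, j))"
  proof (rule sum.cong)
    fix h assume h: "h \<in> carrier G"
    show "(\<Sum>g\<in>carrier G. \<iota> (a h) * \<iota> (b (inv\<^bsub>G\<^esub> h \<otimes>\<^bsub>G\<^esub> g)) * \<phi> g $$ (i, j)) =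
        (\<Sum>k\<in>carrier G. \<iota> (a h) * \<iota> (b k) * \<phi> (h \<otimes>\<^bsub>G\<^esub> k) $$ (i, j))"
      by (rule sum.reindex_bij_witness[of _ "\<lambda>k. h \<otimes>\<^bsub>G\<^esub> k" "\<lambda>g. inv\<^bsub>G\<^esub> h \<otimes>\<^bsub>G\<^esub> g"])
        (use h in \<open>simp_all add: m_assoc[symmetric]\<close>)
  qed simp
  also have "\<dots> = (\<Sum>h\<in>carrier G. \<Sum>k\<in>carrier G. \<Sum>l<n. (\<iota> (a h) * \<phi> h $$ (i, l)) * (\<iota> (b k) * \<phi> k $$ (l, j)))"
    by (intro sum.cong) (simp_all add: \<phi>_mult sum_distrib_left mult_ac)
  also have "\<dots> = (\<Sum>h\<in>carrier G. \<Sum>l<n. \<Sum>k\<in>carrier G. (\<iota> (a h) * \<phi> h $$ (i, l)) * (\<iota> (b k) * \<phi> k $$ (l, j)))"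
    by (intro sum.cong sum.swap) simp
  also have "\<dots> = (\<Sum>l<n. \<Sum>h\<in>carrier G. \<Sum>k\<in>carrier G. (\<iota> (a h) * \<phi> h $$ (i, l)) * (\<iota> (b k) * \<phi> k $$ (l, j)))"
    by (rule sum.swap)
  also have "\<dots> = (alg_rep G n \<iota> \<phi> a * alg_rep G n \<iota> \<phi> b) $$ (i, j)"
    using ij by (simp add: alg_rep_def scalar_prod_def lessThan_atLeast0 sum_product)
  finally show "alg_rep G n \<iota> \<phi> (a \<otimes>\<^bsub>group_algebra TYPE('f) G\<^esub> b) $$ (i, j) =
      (alg_rep G n \<iota> \<phi> a * alg_rep G n \<iota> \<phi> b) $$ (i, j)" .
qed (simp_all add: alg_rep_def)

text \<open>Equal images mean that the combination of the matrices \<open>\<phi> g\<close> with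
  coefficients \<open>\<iota> (a g - b g)\<close> vanishes; multiply it by \<open>\<phi> h\<close>
  and take the trace. Traces, unlike the matrices, can be added up to the regular character.\<close>

lemma alg_rep_eq_imp_trace_sum:
  fixes \<iota> :: "'f::field \<Rightarrow> 'e::field"
  assumes "Group.group G" "field_hom \<iota>" and \<phi>: "\<phi> \<in> hom G (GL n TYPE('e))"
    and eq: "alg_rep G n \<iota> \<phi> a = alg_rep G n \<iota> \<phi> b" and h: "h \<in> carrier G"
  shows "(\<Sum>g\<in>carrier G. \<iota> (a g - b g) * mat_trace (\<phi> (g \<otimes>\<^bsub>G\<^esub> h))) = 0"
proof -
  interpret Group.group G by fact
  interpret field_hom \<iota> by fact
  have \<phi>_mat: "\<phi> g \<in> carrier_mat n n" if "g \<in> carrier G" for g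
    using that \<phi> by (intro GL_carrier_mat) (auto simp: hom_def)
  have coeff: "(\<Sum>g\<in>carrier G. \<iota> (a g - b g) * \<phi> g $$ (i, l)) = 0" if "i < n" "l < n" for i l
  proof -
    have "alg_rep G n \<iota> \<phi> a $$ (i, l) = alg_rep G n \<iota> \<phi> b $$ (i, l)" using eq by simp
    then show ?thesis
      using that by (simp add: alg_rep_def hom_minus left_diff_distrib sum_subtractf)
  qed
  have "(\<Sum>g\<in>carrier G. \<iota> (a g - b g) * mat_trace (\<phi> (g \<otimes>\<^bsub>G\<^esub> h))) =
      (\<Sum>g\<in>carrier G. \<Sum>i<n. \<Sum>l<n. \<iota> (a g - b g) * \<phi> g $$ (i, l) * \<phi> h $$ (l, i))"
    using h by (intro sum.cong)
      (simp_all add: Group.hom_mult[OF \<phi>] GL_simps mat_trace_mult[OF \<phi>_mat \<phi>_mat] sum_distrib_left mult_ac)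
  also have "\<dots> = (\<Sum>i<n. \<Sum>g\<in>carrier G. \<Sum>l<n. \<iota> (a g - b g) * \<phi> g $$ (i, l) * \<phi> h $$ (l, i))"
    by (rule sum.swap)
  also have "\<dots> = (\<Sum>i<n. \<Sum>l<n. \<Sum>g\<in>carrier G. \<iota> (a g - b g) * \<phi> g $$ (i, l) * \<phi> h $$ (l, i))"
    by (intro sum.cong sum.swap) simp
  also have "\<dots> = (\<Sum>i<n. \<Sum>l<n. (\<Sum>g\<in>carrier G. \<iota> (a g - b g) * \<phi> g $$ (i, l)) * \<phi> h $$ (l, i))"
    by (simp add: sum_distrib_right)
  also have "\<dots> = 0" by (simp add: coeff)
  finally show ?thesis .
qed

text \<open>The trace of the \<open>i\<close>-th power of the companion matrix in
  \<open>rotation_pow\<close>, that is, the sum of the \<open>i\<close>-th powers of the two roots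
  of z^2 - t z + 1.\<close>

definition rot_trace :: "'a::comm_ring_1 \<Rightarrow> nat \<Rightarrow> 'a" where
  "rot_trace t i = 2 * cheb t (Suc i) - t * cheb t i"

lemma cheb_sqrt3:
  fixes s :: "'a::comm_ring_1"
  assumes "s\<^sup>2 = 3"
  shows "cheb s 2 = s" "cheb s 3 = 2" "cheb s 4 = s" "cheb s 5 = 1" "cheb s 6 = 0" "cheb s 7 = -1"
    "cheb s 8 = -s" "cheb s 9 = -2" "cheb s 10 = -s" "cheb s 11 = -1" "cheb s 12 = 0"
proof -
  have s: "s * s = 3" using assms by (simp add: power2_eq_square)
  have step: "cheb s (n + 2) = s * cheb s (n + 1) - cheb s n" for n by simp
  show c2: "cheb s 2 = s" using step[of 0] by (simp add: numeral_2_eq_2)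
  show c3: "cheb s 3 = 2" using s by (simp add: numeral_3_eq_3)
  show c4: "cheb s 4 = s" using step[of 2] c2 c3 by simp
  show c5: "cheb s 5 = 1" using step[of 3] s c3 c4 by simp
  show c6: "cheb s 6 = 0" using step[of 4] c4 c5 by simp
  show c7: "cheb s 7 = -1" using step[of 5] c5 c6 by simp
  show c8: "cheb s 8 = -s" using step[of 6] c6 c7 by simp
  show c9: "cheb s 9 = -2" using step[of 7] s c7 c8 by simp
  show c10: "cheb s 10 = -s" using step[of 8] c8 c9 by simp
  show c11: "cheb s 11 = -1" using step[of 9] s c9 c10 by simp
  show c12: "cheb s 12 = 0" using step[of 10] c10 c11 by simp
qed

lemma less_12_cases:
  assumes "i < (12::nat)"
  shows "i \<in> {0, 1, 2, 3, 4, 5, 6, 7, 8, 9, 10, 11}"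
  using assms by (simp only: insert_iff empty_iff) presburger

text \<open>The twelve traces are 2, s, 1, 0, -1, -s, -2, -s, -1, 0, 1, s. Separating the multiples
  of \<open>s\<close> leaves coefficients from the base field even when \<open>s\<close> lies
  outside it.\<close>

lemma rot_trace_sqrt3:
  fixes \<iota> :: "'f::field \<Rightarrow> 'e::field"
  assumes "field_hom \<iota>" "s\<^sup>2 = 3" "i < 12"
  shows "rot_trace s i = \<iota> ([2, 0, 1, 0, -1, 0, -2, 0, -1, 0, 1, 0] ! i) +
    s * \<iota> ([0, 1, 0, 0, 0, -1, 0, -1, 0, 0, 0, 1] ! i)"
proof -
  interpret field_hom \<iota> by fact
  have s: "s * s = 3" using assms(2) by (simp add: power2_eq_square)
  from less_12_cases[OF assms(3)] show ?thesis
    by (elim insertE emptyE) (simp_all add: rot_trace_def cheb_sqrt3[OF assms(2)] s hom_uminus hom_numeral)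
qed

text \<open>The regular character at \<open>x [^] i\<close>: the linear characters give the first
  two terms, each character of degree 2 counts twice, and the last term is the joint share of the
  two faithful ones.\<close>

lemma regular_trace_sum:
  assumes "i < 12"
  shows "2 + 2 * (-1) ^ i + 2 * (rot_trace 0 i + rot_trace 1 i + rot_trace (-1) i) +
      4 * ([2, 0, 1, 0, -1, 0, -2, 0, -1, 0, 1, 0] ! i) = (if i = 0 then 24 else 0 :: 'f::field)"
  using less_12_cases[OF assms]
  by (elim insertE emptyE) (simp_all add: rot_trace_def numeral_eq_Suc)

section \<open>Units of products and cardinalities\<close>

lemma units_of_product_group:
  "units_of (product_group I M) = product_group I (\<lambda>i. units_of (M i))"
proof -
  have "Units (product_group I M) = (\<Pi>\<^sub>E i\<in>I. Units (M i))"
  proof (intro equalityI subsetI)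
    fix x assume "x \<in> Units (product_group I M)"
    then obtain y where x: "x \<in> (\<Pi>\<^sub>E i\<in>I. carrier (M i))" and y: "y \<in> (\<Pi>\<^sub>E i\<in>I. carrier (M i))"
      and eq: "(\<lambda>i\<in>I. y i \<otimes>\<^bsub>M i\<^esub> x i) = (\<lambda>i\<in>I. \<one>\<^bsub>M i\<^esub>)" "(\<lambda>i\<in>I. x i \<otimes>\<^bsub>M i\<^esub> y i) = (\<lambda>i\<in>I. \<one>\<^bsub>M i\<^esub>)"
      by (auto simp: Units_def)
    have "y i \<otimes>\<^bsub>M i\<^esub> x i = \<one>\<^bsub>M i\<^esub>" "x i \<otimes>\<^bsub>M i\<^esub> y i = \<one>\<^bsub>M i\<^esub>" if "i \<in> I" for i
      using fun_cong[OF eq(1), of i] fun_cong[OF eq(2), of i] that by simp_all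
    then show "x \<in> (\<Pi>\<^sub>E i\<in>I. Units (M i))"
      using x y by (fastforce simp: Units_def PiE_iff)
  next
    fix x assume x: "x \<in> (\<Pi>\<^sub>E i\<in>I. Units (M i))"
    then have "\<forall>i\<in>I. \<exists>y\<in>carrier (M i). y \<otimes>\<^bsub>M i\<^esub> x i = \<one>\<^bsub>M i\<^esub> \<and> x i \<otimes>\<^bsub>M i\<^esub> y = \<one>\<^bsub>M i\<^esub>"
      by (auto simp: Units_def PiE_iff)
    then obtain y where y: "\<And>i. i \<in> I \<Longrightarrow> y i \<in> carrier (M i) \<and> y i \<otimes>\<^bsub>M i\<^esub> x i = \<one>\<^bsub>M i\<^esub> \<and> x i \<otimes>\<^bsub>M i\<^esub> y i = \<one>\<^bsub>M i\<^esub>"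
      by metis
    have "x \<in> (\<Pi>\<^sub>E i\<in>I. carrier (M i))" using x by (auto simp: Units_def PiE_iff)
    then show "x \<in> Units (product_group I M)"
      using y by (auto simp: Units_def intro!: bexI[of _ "restrict y I"])
  qed
  then show ?thesis by (simp add: units_of_def product_group_def)
qed

lemma units_of_DirProd: "units_of (M \<times>\<times> N) = units_of M \<times>\<times> units_of N"
proof -
  have "Units (M \<times>\<times> N) = Units M \<times> Units N"
    by (fastforce simp: Units_def)
  then show ?thesis by (simp add: units_of_def DirProd_def)
qed

text \<open>Because \<open>h\<close> preserves products and the identity and is injective, an
  equation saying that a product is 1 holds in \<open>M\<close> iff it holds for the images in
  \<open>N\<close>; hence units correspond to units.\<close>

lemma units_of_iso:
  assumes h: "h \<in> iso M N" and one: "h \<one>\<^bsub>M\<^esub> = \<one>\<^bsub>N\<^esub>" and "\<one>\<^bsub>M\<^esub> \<in> carrier M"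
    and closed: "\<And>x y. x \<in> carrier M \<Longrightarrow> y \<in> carrier M \<Longrightarrow> x \<otimes>\<^bsub>M\<^esub> y \<in> carrier M"
  shows "units_of M \<cong> units_of N"
proof -
  have mult: "\<And>x y. x \<in> carrier M \<Longrightarrow> y \<in> carrier M \<Longrightarrow> h (x \<otimes>\<^bsub>M\<^esub> y) = h x \<otimes>\<^bsub>N\<^esub> h y"
    and inj: "inj_on h (carrier M)" and img: "h ` carrier M = carrier N"
    using h by (auto simp: iso_def hom_def bij_betw_def)
  have prod_one: "x \<otimes>\<^bsub>M\<^esub> y = \<one>\<^bsub>M\<^esub> \<longleftrightarrow> h x \<otimes>\<^bsub>N\<^esub> h y = \<one>\<^bsub>N\<^esub>"
    if "x \<in> carrier M" "y \<in> carrier M" for x y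
    using that mult one inj_on_eq_iff[OF inj closed[OF that] assms(3)] by auto
  have "h ` Units M = Units N"
    unfolding Units_def img[symmetric] using prod_one by (fastforce simp: image_iff)
  moreover have "Units M \<subseteq> carrier M" by (auto simp: Units_def)
  ultimately have "h \<in> iso (units_of M) (units_of N)"
    using mult inj unfolding iso_iff hom_def units_of_def
    by (auto simp: inj_on_def subset_iff)
  then show ?thesis by (auto simp: is_iso_def)
qed

text \<open>Invertible matrices of size 1 are the nonzero scalars, and these are the powers of a
  generator, with exponents taken modulo q - 1.\<close>

lemma GL_1_iso_integer_mod_group:
  "GL 1 TYPE('f::{field, finite}) \<cong> integer_mod_group (CARD('f) - 1)"
proof -
  define n where "n = CARD('f) - 1"
  obtain g :: 'f where g: "g \<noteq> 0" "\<And>i j. g ^ i = g ^ j \<longleftrightarrow> [i = j] (mod n)"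
      "\<And>x. x \<noteq> 0 \<Longrightarrow> \<exists>i<n. x = g ^ i"
    unfolding n_def using finite_field_generator[where 'a = 'f] by (metis finite)
  \<comment> \<open>For \<open>n = 0\<close>, \<open>integer_mod_group n\<close> would be the
    infinite cyclic group.\<close>
  have "n > 0" using g(3)[of 1] by auto
  have units: "carrier (GL 1 TYPE('f)) = mat1 ` {x. x \<noteq> 0}"
  proof -
    have "mat1 c \<in> carrier (GL 1 TYPE('f))" if "c \<noteq> 0" for c
      using that by (intro GL_I[of _ _ "mat1 (inverse c)"]) (simp_all add: one_mat_1)
    moreover have "c \<noteq> 0" if "mat1 c \<in> carrier (GL 1 TYPE('f))" for c
    proof -
      from that obtain d where "mat1 d * mat1 c = mat1 1"
        unfolding GL_simps Units_def ring_mat_simps carrier_mat_1_eq one_mat_1 by auto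
      then show ?thesis by auto
    qed
    moreover have "carrier (GL 1 TYPE('f)) \<subseteq> range mat1"
      using GL_carrier_mat carrier_mat_1_eq by blast
    ultimately show ?thesis by blast
  qed
  define h where "h = (\<lambda>i. mat1 (g ^ nat i))"
  have "h \<in> iso (integer_mod_group n) (GL 1 TYPE('f))"
    unfolding iso_iff
  proof (intro conjI)
    show "h \<in> hom (integer_mod_group n) (GL 1 TYPE('f))"
    proof (rule homI)
      fix i j assume ij: "i \<in> carrier (integer_mod_group n)" "j \<in> carrier (integer_mod_group n)"
      show "h i \<in> carrier (GL 1 TYPE('f))" unfolding h_def units using g(1) by simp
      have "nat ((i + j) mod int n) = (nat i + nat j) mod n"
        using ij \<open>n > 0\<close> by (simp add: carrier_integer_mod_group nat_mod_distrib nat_add_distrib)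
      then have "g ^ nat ((i + j) mod int n) = g ^ (nat i + nat j)"
        by (simp only: g(2)) (simp add: cong_def)
      then show "h (i \<otimes>\<^bsub>integer_mod_group n\<^esub> j) = h i \<otimes>\<^bsub>GL 1 TYPE('f)\<^esub> h j"
        by (simp add: h_def GL_simps power_add)
    qed
    show "h ` carrier (integer_mod_group n) = carrier (GL 1 TYPE('f))"
    proof (intro equalityI subsetI)
      fix A assume "A \<in> carrier (GL 1 TYPE('f))"
      then obtain c where "A = mat1 c" "c \<noteq> 0" unfolding units by blast
      then obtain i where "i < n" "A = mat1 (g ^ i)" using g(3) by metis
      then show "A \<in> h ` carrier (integer_mod_group n)"
        by (intro image_eqI[of _ _ "int i"]) (auto simp: h_def carrier_integer_mod_group)
    qed (use g(1) in \<open>unfold h_def units, auto\<close>)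
    show "inj_on h (carrier (integer_mod_group n))"
      using \<open>n > 0\<close> by (auto simp: inj_on_def h_def g(2) carrier_integer_mod_group cong_def zless_nat_eq_int_zless nat_less_iff)
  qed
  then show ?thesis
    unfolding n_def[symmetric] using group.iso_sym[OF group_integer_mod_group] is_iso_def by blast
qed

section \<open>Cardinalities of the matrix algebras and of the group algebra\<close>

lemma card_carrier_mat_1:
  assumes "finite (UNIV :: 'a set)"
  shows "finite (carrier_mat 1 1 :: 'a mat set)" "card (carrier_mat 1 1 :: 'a mat set) = CARD('a)"
  using assms unfolding carrier_mat_1_eq by (auto intro!: card_image injI)

lemma card_carrier_mat_2:
  assumes fin: "finite (UNIV :: 'a set)"
  shows "finite (carrier_mat 2 2 :: 'a mat set)" "card (carrier_mat 2 2 :: 'a mat set) = CARD('a) ^ 4"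
proof -
  define h where "h = (\<lambda>(a, b, c, d). mat2 a b c (d :: 'a))"
  have "inj h"
  proof (rule injI)
    fix p p' assume "h p = h p'"
    then have "h p $$ (i, j) = h p' $$ (i, j)" for i j by simp
    from this[of 0 0] this[of 0 1] this[of 1 0] this[of 1 1] show "p = p'"
      by (auto simp: h_def mat2_def prod_eq_iff case_prod_unfold)
  qed
  moreover have "range h = carrier_mat 2 2"
  proof (intro equalityI subsetI)
    fix A :: "'a mat" assume "A \<in> carrier_mat 2 2"
    then have "A = h (A $$ (0, 0), A $$ (0, 1), A $$ (1, 0), A $$ (1, 1))"
      by (intro eq_matI) (auto simp: h_def mat2_def less_2_cases_iff)
    then show "A \<in> range h" by blast
  qed (auto simp: h_def)
  ultimately have bij: "bij_betw h UNIV (carrier_mat 2 2)" by (simp add: bij_betw_def)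
  show "finite (carrier_mat 2 2 :: 'a mat set)"
    using bij_betw_finite[OF bij] fin by (simp add: finite_prod)
  show "card (carrier_mat 2 2 :: 'a mat set) = CARD('a) ^ 4"
    using bij_betw_same_card[OF bij] by (simp add: numeral_eq_Suc)
qed

text \<open>Elements of the group algebra vanish outside \<open>carrier G\<close>, whereas the
  functions counted by \<open>card_PiE\<close> are undefined there; \<open>restrict\<close>
  translates between the two conventions.\<close>

lemma card_group_algebra:
  assumes "finite (carrier G)"
  shows "finite (carrier (group_algebra TYPE('f::{field, finite}) G))"
    and "card (carrier (group_algebra TYPE('f) G)) = CARD('f) ^ card (carrier G)"
proof -
  have bij: "bij_betw (\<lambda>a. restrict a (carrier G)) (carrier (group_algebra TYPE('f) G)) (carrier G \<rightarrow>\<^sub>E UNIV)"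
    by (rule bij_betw_byWitness[of _ "\<lambda>a g. if g \<in> carrier G then a g else 0"])
      (auto simp: group_algebra_def fun_eq_iff PiE_def extensional_def)
  show "finite (carrier (group_algebra TYPE('f) G))"
    using bij_betw_finite[OF bij] assms by (simp add: finite_PiE)
  show "card (carrier (group_algebra TYPE('f) G)) = CARD('f) ^ card (carrier G)"
    using bij_betw_same_card[OF bij] assms by (simp add: card_PiE)
qed

text \<open>Between finite sets of the same size injectivity gives surjectivity, so no preimages
  have to be constructed.\<close>

lemma units_group_algebra_iso:
  fixes G :: "('g, 'm) monoid_scheme" and N :: "('b, 'c) monoid_scheme"
  assumes "Group.group G" "finite (carrier G)"
    and h: "h \<in> hom (group_algebra TYPE('f::{field, finite}) G) N"
    and one: "h (one (group_algebra TYPE('f) G)) = \<one>\<^bsub>N\<^esub>"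
    and inj: "inj_on h (carrier (group_algebra TYPE('f) G))"
    and "finite (carrier N)" "card (carrier N) = CARD('f) ^ card (carrier G)"
  shows "units_of (group_algebra TYPE('f) G) \<cong> units_of N"
proof (rule units_of_iso[where h = h])
  interpret Group.group G by fact
  have "h ` carrier (group_algebra TYPE('f) G) = carrier N"
    using assms(6,7) h card_image[OF inj] card_group_algebra(2)[OF assms(2), where 'f = 'f]
    by (intro card_subset_eq) (auto simp: hom_def)
  then show "h \<in> iso (group_algebra TYPE('f) G) N"
    using h inj by (simp add: iso_iff)
  show "one (group_algebra TYPE('f) G) \<in> carrier (group_algebra TYPE('f) G)"
    by (auto simp: group_algebra_def)
  show "a \<otimes>\<^bsub>group_algebra TYPE('f) G\<^esub> b \<in> carrier (group_algebra TYPE('f) G)" for a b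
    by (simp add: group_algebra_def)
qed (fact one)

section \<open>The regular character\<close>

context C3_Q8
begin

section \<open>Existence of the representations, and the order of the group\<close>

definition is_rep1 :: "'e::field \<Rightarrow> 'e \<Rightarrow> ('a \<Rightarrow> 'e mat) \<Rightarrow> bool" where
  "is_rep1 a b \<phi> \<longleftrightarrow> \<phi> \<in> hom G (GL 1 TYPE('e)) \<and>
     (\<forall>i e :: nat. mat_trace (\<phi> (x [^] i \<otimes> y [^] e)) = a ^ i * b ^ e)"

text \<open>The bound \<open>e < 2\<close> matters: \<open>y [^] 2\<close> is a power of
  \<open>x\<close>, where the trace is not zero in general.\<close>

definition is_rep2 :: "'e::field \<Rightarrow> ('a \<Rightarrow> 'e mat) \<Rightarrow> bool" where
  "is_rep2 t \<phi> \<longleftrightarrow> \<phi> \<in> hom G (GL 2 TYPE('e)) \<and>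
     (\<forall>(i::nat) (e::nat). e < 2 \<longrightarrow> mat_trace (\<phi> (x [^] i \<otimes> y [^] e)) = (if e = 0 then rot_trace t i else 0))"

lemma is_rep1_exists:
  fixes a b :: "'e::field"
  assumes "a\<^sup>2 = 1" "b\<^sup>2 = 1"
  shows "\<exists>\<phi>. is_rep1 a b \<phi>"
  using one_dim_rep_exists[OF assms] unfolding is_rep1_def by metis

text \<open>The scalar \<epsilon> by which x^6 = y^2 acts is 1 if t^2 = 1, and -1 if t = 0 or t^2 =
  3. In the latter cases the form a^2 + a b t + b^2 has to represent -1, and the two squares
  enter.\<close>

lemma is_rep2_exists:
  fixes t u v :: "'e::field"
  assumes "t = 0 \<or> t\<^sup>2 = 1 \<or> t\<^sup>2 = 3" and uv: "u\<^sup>2 + v\<^sup>2 = -1"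
  shows "\<exists>\<phi>. is_rep2 t \<phi>"
proof -
  have c: "cheb t 5 = (t\<^sup>2)\<^sup>2 - 3 * t\<^sup>2 + 1" "cheb t 6 = t * (t\<^sup>2 - 1) * (t\<^sup>2 - 3)"
    by (simp_all add: numeral_eq_Suc algebra_simps)
  obtain a b \<epsilon> where abe: "cheb t 6 = 0" "cheb t 5 = - \<epsilon>" "\<epsilon>\<^sup>2 = 1" "a\<^sup>2 + a * b * t + b\<^sup>2 = \<epsilon>"
  proof -
    consider "t = 0" | "t\<^sup>2 = 1" | "t\<^sup>2 = 3" using assms(1) by blast
    then show thesis
    proof cases
      case 1
      moreover have "cheb 0 6 = (0 :: 'e)" "cheb 0 5 = (1 :: 'e)" by (simp_all add: numeral_eq_Suc)
      ultimately show thesis using that[of "-1" u v] uv by simp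
    next
      case 2
      then show thesis using that[of 1 1 0] by (simp add: c)
    next
      case 3
      \<comment> \<open>Found by completing the square: here a + b t / 2 = u and b = 2 v.\<close>
      have "(u - v * t)\<^sup>2 + (u - v * t) * (2 * v) * t + (2 * v)\<^sup>2 = u\<^sup>2 + (4 - t\<^sup>2) * v\<^sup>2"
        by (simp add: power2_eq_square algebra_simps)
      also have "\<dots> = -1" using uv by (simp add: 3)
      finally show thesis using that[of "-1" "u - v * t" "2 * v"] by (simp add: c 3)
    qed
  qed
  obtain \<phi> where "\<phi> \<in> hom G (GL 2 TYPE('e))"
    "\<And>i. mat_trace (\<phi> (x [^] (i::nat) \<otimes> y [^] (0::nat))) = 2 * cheb t (Suc i) - t * cheb t i"
    "\<And>i. mat_trace (\<phi> (x [^] (i::nat) \<otimes> y [^] (1::nat))) = 0"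
    using two_dim_rep_exists[OF abe] by metis
  then have "is_rep2 t \<phi>"
    unfolding is_rep2_def rot_trace_def by (auto simp: less_2_cases_iff simp del: nat_pow_0 nat_pow_Suc)
  then show ?thesis by blast
qed

text \<open>The relations alone bound the order only from above. That nothing collapses further is
  seen in a complex representation with \<open>s\<close> the square root of 3, where the identity is
  the only one of the 24 normal forms with trace 2.\<close>

lemma normal_form_eq_one:
  assumes eq: "x [^] (i::nat) \<otimes> y [^] (e::nat) = \<one>" and "i < 12" "e < 2"
  shows "i = 0 \<and> e = 0"
proof -
  define s where "s = complex_of_real (sqrt 3)"
  have s: "s\<^sup>2 = 3" by (simp add: s_def flip: of_real_power)
  have "\<i>\<^sup>2 + 0\<^sup>2 = (-1 :: complex)" by simp
  then obtain \<phi> :: "'a \<Rightarrow> complex mat" where \<phi>: "is_rep2 s \<phi>"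
    using is_rep2_exists s by metis
  have tr: "mat_trace (\<phi> (x [^] k \<otimes> y [^] l)) = (if l = 0 then rot_trace s k else 0)" if "l < 2" for k l :: nat
    using \<phi> that unfolding is_rep2_def by blast
  have "(if e = 0 then rot_trace s i else 0) = rot_trace s 0"
    using tr[OF assms(3), of i] tr[of 0 0] eq by simp
  then have tr2: "(if e = 0 then rot_trace s i else 0) = 2" by (simp add: rot_trace_def)
  then have "e = 0" by (auto split: if_splits)
  moreover have "i = 0"
  proof (rule ccontr)
    assume "i \<noteq> 0"
    \<comment> \<open>For \<open>i\<close> = 1, 5, 7, 11 the trace is \<open>s\<close> or
      \<open>- s\<close>, which must be kept apart from 2.\<close>
    have "s \<noteq> 2" "s \<noteq> - 2" using s by auto
    have "field_hom (\<lambda>z::complex. z)" by unfold_locales auto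
    from rot_trace_sqrt3[OF this s assms(2)] tr2 \<open>e = 0\<close>
    have "[2, 0, 1, 0, -1, 0, -2, 0, -1, 0, 1, 0] ! i + s * [0, 1, 0, 0, 0, -1, 0, -1, 0, 0, 0, 1] ! i = 2"
      by simp
    with less_12_cases[OF assms(2)] \<open>i \<noteq> 0\<close> \<open>s \<noteq> 2\<close> \<open>s \<noteq> - 2\<close> show False
      by (elim insertE emptyE) (simp_all add: minus_equation_iff[of s])
  qed
  ultimately show ?thesis by blast
qed

lemma normal_form_inj:
  "inj_on (\<lambda>(i, e). x [^] (i::nat) \<otimes> y [^] (e::nat)) ({..<12} \<times> {..<2})"
proof (rule inj_onI)
  fix p p' :: "nat \<times> nat"
  assume p: "p \<in> {..<12} \<times> {..<2}" "p' \<in> {..<12} \<times> {..<2}"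
    "(case p of (i, e) \<Rightarrow> x [^] i \<otimes> y [^] e) = (case p' of (i, e) \<Rightarrow> x [^] i \<otimes> y [^] e)"
  obtain i e j d where pp: "p = (i, e)" "p' = (j, d)" by (metis surj_pair)
  have *: "i < 12" "e < 2" "j < 12" "d < 2" and eq: "x [^] i \<otimes> y [^] e = x [^] j \<otimes> y [^] d"
    using p by (simp_all add: pp)
  \<comment> \<open>Cancelling the power of \<open>x\<close> on the left would make a normal form
    containing one \<open>y\<close> equal to 1; the exponent \<open>12 - i + j\<close> stands for j
    - i.\<close>
  have diff: "x [^] i \<noteq> x [^] j \<otimes> y" if "i < 12" for i j :: nat
  proof
    assume "x [^] i = x [^] j \<otimes> y"
    then have "x [^] (12 - i) \<otimes> x [^] i = x [^] (12 - i) \<otimes> x [^] j \<otimes> y"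
      by (simp add: m_assoc)
    then have "x [^] (12 - i) \<otimes> x [^] i = x [^] (12 - i + j) \<otimes> y"
      by (simp only: nat_pow_mult gen_closed)
    moreover have "x [^] (12 - i) \<otimes> x [^] i = \<one>"
      using that x_pow_12 nat_pow_mult[of x "12 - i" i] by (metis gen_closed le_add_diff_inverse2 less_imp_le)
    ultimately have "x [^] (12 - i + j) \<otimes> y [^] (1::nat) = \<one>"
      by (simp only: nat_pow_eone gen_closed)
    then have "x [^] ((12 - i + j) mod 12) \<otimes> y [^] (1::nat) = \<one>"
      by (simp only: x_pow_mod[of "12 - i + j", symmetric])
    from normal_form_eq_one[OF this] show False by simp
  qed
  have same: "i = j" if "x [^] i = x [^] j" "i < 12" "j < 12" for i j :: nat
    using that
  proof (induction i j rule: linorder_wlog)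
    case (le i j)
    have "x [^] i \<otimes> x [^] (j - i) = x [^] j" using le(1) by (simp add: nat_pow_mult)
    then have "x [^] i \<otimes> \<one> = x [^] i \<otimes> x [^] (j - i)" using le(2) by simp
    then have "x [^] (j - i) \<otimes> y [^] (0::nat) = \<one>" by simp
    moreover have "j - i < 12" using le(4) by linarith
    ultimately have "j - i = 0" using normal_form_eq_one[of "j - i" 0] pos2 by blast
    then show ?case using le(1) by simp
  next
    case (sym i j)
    then show ?case by metis
  qed
  have "e = d"
  proof (rule ccontr)
    assume "e \<noteq> d"
    then consider "e = 0" "d = 1" | "e = 1" "d = 0" using * by force
    then show False
    proof cases
      case 1
      then show False using eq diff[of i j] * by (simp add: nat_pow_eone)
    next
      case 2
      then show False using eq[symmetric] diff[of j i] * by (simp add: nat_pow_eone)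
    qed
  qed
  moreover have "i = j" using eq same[of i j] *(1,3) by (simp add: \<open>e = d\<close>)
  ultimately show "p = p'" by (simp add: pp)
qed

lemma finite_carrier: "finite (carrier G)" and card_carrier: "card (carrier G) = 24"
proof -
  have img: "carrier G = (\<lambda>(i, e). x [^] (i::nat) \<otimes> y [^] (e::nat)) ` ({..<12} \<times> {..<2})"
  proof (intro equalityI subsetI)
    fix g assume "g \<in> carrier G"
    then obtain i e :: nat where "g = x [^] i \<otimes> y [^] e" "i < 12" "e < 2"
      by (rule carrier_normal_form)
    then show "g \<in> (\<lambda>(i, e). x [^] (i::nat) \<otimes> y [^] (e::nat)) ` ({..<12} \<times> {..<2})"
      by (intro image_eqI[of _ _ "(i, e)"]) auto
  qed auto
  show "finite (carrier G)" unfolding img by simp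
  show "card (carrier G) = 24" unfolding img by (simp add: card_image[OF normal_form_inj])
qed

text \<open>The character of the regular representation, with the contribution \<open>2 (\<chi> + \<chi>')\<close> of the two
  faithful characters \<open>\<chi>, \<chi>' = A \<plusminus> B \<surd>3\<close> written as \<open>4 A\<close>, so that it stays meaningful over the
  base field when \<open>3\<close> is not a square.\<close>

lemma regular_character:
  fixes \<phi>1 \<phi>2 :: "nat \<Rightarrow> 'a \<Rightarrow> 'f::field mat"
  assumes \<phi>1: "\<And>k. k < 4 \<Longrightarrow> is_rep1 ([1, 1, -1, -1] ! k) ([1, -1, 1, -1] ! k) (\<phi>1 k)"
    and \<phi>2: "\<And>k. k < 3 \<Longrightarrow> is_rep2 ([0, 1, -1] ! k) (\<phi>2 k)"
    and \<iota>: "field_hom (\<iota> :: 'f \<Rightarrow> 'e::field)" and g: "g \<in> carrier G"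
  obtains A B :: 'f
  where "(\<Sum>k<4. mat_trace (\<phi>1 k g)) + 2 * (\<Sum>k<3. mat_trace (\<phi>2 k g)) + 4 * A = (if g = \<one> then 24 else 0)"
    and "\<And>s \<psi>. s\<^sup>2 = 3 \<Longrightarrow> is_rep2 s \<psi> \<Longrightarrow> mat_trace (\<psi> g) = \<iota> A + s * \<iota> B"
proof -
  interpret field_hom \<iota> by fact
  obtain i e :: nat where ie: "g = x [^] i \<otimes> y [^] e" "i < 12" "e < 2"
    using g by (rule carrier_normal_form)
  have one: "g = \<one> \<longleftrightarrow> i = 0 \<and> e = 0"
    using normal_form_eq_one[of i e] ie by auto
  have tr1: "(\<Sum>k<4. mat_trace (\<phi>1 k g)) = 1 + (-1) ^ e + (-1) ^ i + (-1) ^ i * (-1) ^ e"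
    using \<phi>1[of 0] \<phi>1[of 1] \<phi>1[of 2] \<phi>1[of 3] unfolding is_rep1_def ie(1)
    by (simp add: numeral_eq_Suc)
  have tr2: "(\<Sum>k<3. mat_trace (\<phi>2 k g)) = (if e = 0 then rot_trace 0 i + rot_trace 1 i + rot_trace (-1) i else 0)"
    using \<phi>2[of 0] \<phi>2[of 1] \<phi>2[of 2] ie(3) unfolding is_rep2_def ie(1)
    by (simp add: numeral_eq_Suc)
  define A B :: 'f where
    "A = (if e = 0 then [2, 0, 1, 0, -1, 0, -2, 0, -1, 0, 1, 0] ! i else 0)" and
    "B = (if e = 0 then [0, 1, 0, 0, 0, -1, 0, -1, 0, 0, 0, 1] ! i else 0)"
  show thesis
  proof
    show "(\<Sum>k<4. mat_trace (\<phi>1 k g)) + 2 * (\<Sum>k<3. mat_trace (\<phi>2 k g)) + 4 * A = (if g = \<one> then 24 else 0)"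
      unfolding tr1 tr2 one using regular_trace_sum[OF ie(2), where 'f = 'f] ie(3)
      by (auto simp: A_def less_2_cases_iff add_ac)
    fix s :: 'e and \<psi> assume s: "s\<^sup>2 = 3" and "is_rep2 s \<psi>"
    then have "mat_trace (\<psi> g) = (if e = 0 then rot_trace s i else 0)"
      using ie unfolding is_rep2_def by blast
    then show "mat_trace (\<psi> g) = \<iota> A + s * \<iota> B"
      using rot_trace_sqrt3[OF \<iota> s ie(2)] by (simp add: A_def B_def)
  qed
qed

text \<open>As \<Lambda> is supported at the identity, testing with \<open>h = inv k\<close> leaves
  only the term \<open>g = k\<close>: the trace form of the regular representation is nondegenerate
  when 24 is invertible.\<close>

lemma coeffs_eq_zero:
  fixes c \<Lambda> :: "'a \<Rightarrow> 'f::field"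
  assumes \<Lambda>: "\<And>g. g \<in> carrier G \<Longrightarrow> \<Lambda> g = (if g = \<one> then 24 else 0)"
    and sum: "\<And>h. h \<in> carrier G \<Longrightarrow> (\<Sum>g\<in>carrier G. c g * \<Lambda> (g \<otimes> h)) = 0"
    and "(24 :: 'f) \<noteq> 0" and k: "k \<in> carrier G"
  shows "c k = 0"
proof -
  have "g \<otimes> inv k = \<one> \<longleftrightarrow> g = k" if "g \<in> carrier G" for g
    using that k by (metis inv_closed inv_equality inv_inv r_inv)
  then have "(\<Sum>g\<in>carrier G. c g * \<Lambda> (g \<otimes> inv k)) = (\<Sum>g\<in>carrier G. if g = k then 24 * c k else 0)"
    using k by (intro sum.cong) (auto simp: \<Lambda>)
  also have "\<dots> = 24 * c k" using k finite_carrier by simp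
  finally show ?thesis using sum[of "inv k"] k assms(3) by simp
qed

end

section \<open>The decomposition of the unit group\<close>

context C3_Q8
begin

lemma reps_exist:
  fixes ts :: "'e::field list" and u v :: 'e
  assumes "\<And>t. t \<in> set ts \<Longrightarrow> t = 0 \<or> t\<^sup>2 = 1 \<or> t\<^sup>2 = 3" and "length ts = n"
    and uv: "u\<^sup>2 + v\<^sup>2 = -1"
  obtains \<phi>1 \<phi>2 :: "nat \<Rightarrow> 'a \<Rightarrow> 'e mat"
  where "\<And>k. k < 4 \<Longrightarrow> is_rep1 ([1, 1, -1, -1] ! k) ([1, -1, 1, -1] ! k) (\<phi>1 k)"
    and "\<And>k. k < n \<Longrightarrow> is_rep2 (ts ! k) (\<phi>2 k)"
proof -
  have "\<exists>\<phi>. is_rep1 ([1, 1, -1, -1] ! k :: 'e) ([1, -1, 1, -1] ! k) \<phi>" if "k < 4" for k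
  proof (rule is_rep1_exists)
    show "([1, 1, -1, -1] ! k :: 'e)\<^sup>2 = 1" "([1, -1, 1, -1] ! k :: 'e)\<^sup>2 = 1"
      using that by (auto simp: numeral_eq_Suc less_Suc_eq)
  qed
  moreover have "\<exists>\<phi>. is_rep2 (ts ! k) \<phi>" if "k < n" for k
    by (rule is_rep2_exists[OF _ uv]) (use assms(1,2) that in \<open>auto simp del: power2_eq_1_iff\<close>)
  ultimately show thesis using that by metis
qed

text \<open>Core shared by both cases: \<open>c\<close> is orthogonal to all translates of the
  regular character. The cases differ only in how the share \<open>A\<close> of the two faithful
  characters is shown to contribute nothing, and this is isolated in assumption
  \<open>c3\<close>.\<close>

lemma kernel_trivial:
  fixes \<phi>1 \<phi>2 :: "nat \<Rightarrow> 'a \<Rightarrow> 'f::field mat" and c :: "'a \<Rightarrow> 'f"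
  assumes \<phi>1: "\<And>k. k < 4 \<Longrightarrow> is_rep1 ([1, 1, -1, -1] ! k) ([1, -1, 1, -1] ! k) (\<phi>1 k)"
    and \<phi>2: "\<And>k. k < 3 \<Longrightarrow> is_rep2 ([0, 1, -1] ! k) (\<phi>2 k)"
    and \<iota>: "field_hom (\<iota> :: 'f \<Rightarrow> 'e::field)" and "(24 :: 'f) \<noteq> 0"
    and c1: "\<And>k h. k < 4 \<Longrightarrow> h \<in> carrier G \<Longrightarrow> (\<Sum>g\<in>carrier G. c g * mat_trace (\<phi>1 k (g \<otimes> h))) = 0"
    and c2: "\<And>k h. k < 3 \<Longrightarrow> h \<in> carrier G \<Longrightarrow> (\<Sum>g\<in>carrier G. c g * mat_trace (\<phi>2 k (g \<otimes> h))) = 0"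
    and c3: "\<And>A B h. (\<And>s \<psi> g. g \<in> carrier G \<Longrightarrow> s\<^sup>2 = 3 \<Longrightarrow> is_rep2 s \<psi> \<Longrightarrow>
        mat_trace (\<psi> g) = \<iota> (A g) + s * \<iota> (B g)) \<Longrightarrow> h \<in> carrier G \<Longrightarrow>
        (\<Sum>g\<in>carrier G. c g * A (g \<otimes> h)) = 0"
    and "k \<in> carrier G"
  shows "c k = 0"
proof -
  have "\<forall>g\<in>carrier G. \<exists>A B.
      (\<Sum>k<4. mat_trace (\<phi>1 k g)) + 2 * (\<Sum>k<3. mat_trace (\<phi>2 k g)) + 4 * A = (if g = \<one> then 24 else 0) \<and>
      (\<forall>s \<psi>. s\<^sup>2 = 3 \<longrightarrow> is_rep2 s \<psi> \<longrightarrow> mat_trace (\<psi> g) = \<iota> A + s * \<iota> B)"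
    using regular_character[OF \<phi>1 \<phi>2 \<iota>] by metis
  then obtain A B where AB: "\<And>g. g \<in> carrier G \<Longrightarrow>
      (\<Sum>k<4. mat_trace (\<phi>1 k g)) + 2 * (\<Sum>k<3. mat_trace (\<phi>2 k g)) + 4 * A g = (if g = \<one> then 24 else 0) \<and>
      (\<forall>s \<psi>. s\<^sup>2 = 3 \<longrightarrow> is_rep2 s \<psi> \<longrightarrow> mat_trace (\<psi> g) = \<iota> (A g) + s * \<iota> (B g))"
    by metis
  show ?thesis
  proof (rule coeffs_eq_zero[where \<Lambda> = "\<lambda>g. (\<Sum>k<4. mat_trace (\<phi>1 k g)) + 2 * (\<Sum>k<3. mat_trace (\<phi>2 k g)) + 4 * A g"])
    fix h assume h: "h \<in> carrier G"
    have "(\<Sum>g\<in>carrier G. c g * ((\<Sum>k<4. mat_trace (\<phi>1 k (g \<otimes> h))) +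
          2 * (\<Sum>k<3. mat_trace (\<phi>2 k (g \<otimes> h))) + 4 * A (g \<otimes> h))) =
        (\<Sum>g\<in>carrier G. \<Sum>k<4. c g * mat_trace (\<phi>1 k (g \<otimes> h))) +
        2 * (\<Sum>g\<in>carrier G. \<Sum>k<3. c g * mat_trace (\<phi>2 k (g \<otimes> h))) +
        4 * (\<Sum>g\<in>carrier G. c g * A (g \<otimes> h))"
      by (simp add: distrib_left sum.distrib sum_distrib_left mult_ac)
    also have "(\<Sum>g\<in>carrier G. \<Sum>k<4. c g * mat_trace (\<phi>1 k (g \<otimes> h))) = 0"
      by (subst sum.swap) (simp add: c1 h)
    also have "(\<Sum>g\<in>carrier G. \<Sum>k<3. c g * mat_trace (\<phi>2 k (g \<otimes> h))) = 0"
      by (subst sum.swap) (simp add: c2 h)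
    also have "(\<Sum>g\<in>carrier G. c g * A (g \<otimes> h)) = 0"
      by (rule c3[of A B]) (use AB h in blast)+
    finally show "(\<Sum>g\<in>carrier G. c g * ((\<Sum>k<4. mat_trace (\<phi>1 k (g \<otimes> h))) +
          2 * (\<Sum>k<3. mat_trace (\<phi>2 k (g \<otimes> h))) + 4 * A (g \<otimes> h))) = 0" by simp
  qed (use AB assms in auto)
qed

lemma units_group_algebra_split:
  fixes s :: "'f::{field, finite}"
  assumes "(2 :: 'f) \<noteq> 0" "(24 :: 'f) \<noteq> 0" and s: "s\<^sup>2 = 3"
  shows "units_of (group_algebra TYPE('f) G) \<cong>
    product_group {..<4} (\<lambda>_::nat. GL 1 TYPE('f)) \<times>\<times> product_group {..<5} (\<lambda>_::nat. GL 2 TYPE('f))"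
proof -
  obtain u v :: 'f where uv: "u\<^sup>2 + v\<^sup>2 = -1" using minus_one_sum_two_squares[where 'a = 'f] by auto
  have len: "length [0, 1, -1, s, -s] = 5" by simp
  have ts: "t = 0 \<or> t\<^sup>2 = 1 \<or> t\<^sup>2 = 3" if "t \<in> set [0, 1, -1, s, -s]" for t
    using that s by auto
  obtain \<phi>1 \<phi>2 :: "nat \<Rightarrow> 'a \<Rightarrow> 'f mat"
    where \<phi>1: "\<And>k. k < 4 \<Longrightarrow> is_rep1 ([1, 1, -1, -1] ! k) ([1, -1, 1, -1] ! k) (\<phi>1 k)"
      and \<phi>2: "\<And>k. k < 5 \<Longrightarrow> is_rep2 ([0, 1, -1, s, -s] ! k) (\<phi>2 k)"
    using reps_exist[OF ts len uv] by blast
  have hom1: "\<phi>1 k \<in> hom G (GL 1 TYPE('f))" if "k < 4" for k using \<phi>1[OF that] is_rep1_def by blast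
  have hom2: "\<phi>2 k \<in> hom G (GL 2 TYPE('f))" if "k < 5" for k using \<phi>2[OF that] is_rep2_def by blast
  have id: "field_hom (\<lambda>z::'f. z)" by unfold_locales auto
  define h where "h = (\<lambda>a. (\<lambda>k\<in>{..<4}. alg_rep G 1 (\<lambda>z. z) (\<phi>1 k) a, \<lambda>k\<in>{..<5}. alg_rep G 2 (\<lambda>z. z) (\<phi>2 k) a))"
  define N where "N = product_group {..<4} (\<lambda>_::nat. ring_mat TYPE('f) 1 ()) \<times>\<times> product_group {..<5} (\<lambda>_::nat. ring_mat TYPE('f) 2 ())"
  note rep_one = alg_rep_one[OF is_group finite_carrier id]
  note rep_mult = alg_rep_mult[OF is_group finite_carrier id]
  have "units_of (group_algebra TYPE('f) G) \<cong> units_of N"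
  proof (rule units_group_algebra_iso[OF is_group finite_carrier, where h = h])
    show "h \<in> hom (group_algebra TYPE('f) G) N"
      by (rule homI) (auto simp del: One_nat_def simp: h_def N_def ring_mat_simps rep_mult[OF hom1] rep_mult[OF hom2] cong: restrict_cong)
    show "h \<one>\<^bsub>group_algebra TYPE('f) G\<^esub> = \<one>\<^bsub>N\<^esub>"
      by (auto simp del: One_nat_def simp: h_def N_def ring_mat_simps rep_one[OF hom1] rep_one[OF hom2] cong: restrict_cong)
    have card1: "finite (carrier_mat 1 1 :: 'f mat set)" "card (carrier_mat 1 1 :: 'f mat set) = CARD('f)"
      and card2: "finite (carrier_mat 2 2 :: 'f mat set)" "card (carrier_mat 2 2 :: 'f mat set) = CARD('f) ^ 4"
      by (rule card_carrier_mat_1 card_carrier_mat_2; simp)+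
    show "finite (carrier N)"
      unfolding N_def carrier_DirProd carrier_product_group ring_mat_simps
      using card1 card2 by (intro finite_cartesian_product finite_PiE) auto
    \<comment> \<open>The dimensions add up: 4 * 1 + 5 * 4 = 24.\<close>
    show "card (carrier N) = CARD('f) ^ card (carrier G)"
      unfolding N_def carrier_DirProd carrier_product_group ring_mat_simps card_cartesian_product
      by (simp add: card_PiE card1[simplified] card2 card_carrier flip: power_mult power_add)
    show "inj_on h (carrier (group_algebra TYPE('f) G))"
    proof (rule inj_onI)
      fix a b assume ab: "a \<in> carrier (group_algebra TYPE('f) G)" "b \<in> carrier (group_algebra TYPE('f) G)"
        and hab: "h a = h b"
      have eq1: "alg_rep G 1 (\<lambda>z. z) (\<phi>1 k) a = alg_rep G 1 (\<lambda>z. z) (\<phi>1 k) b" if "k < 4" for k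
        using arg_cong[OF hab, of "\<lambda>z. fst z k"] that by (simp add: h_def del: One_nat_def)
      have eq2: "alg_rep G 2 (\<lambda>z. z) (\<phi>2 k) a = alg_rep G 2 (\<lambda>z. z) (\<phi>2 k) b" if "k < 5" for k
        using arg_cong[OF hab, of "\<lambda>z. snd z k"] that by (simp add: h_def del: One_nat_def)
      define c where "c = (\<lambda>g. a g - b g)"
      have c1: "(\<Sum>g\<in>carrier G. c g * mat_trace (\<phi>1 k (g \<otimes> l))) = 0" if "k < 4" "l \<in> carrier G" for k l
        unfolding c_def using alg_rep_eq_imp_trace_sum[OF is_group id hom1 eq1] that by blast
      have c2: "(\<Sum>g\<in>carrier G. c g * mat_trace (\<phi>2 k (g \<otimes> l))) = 0" if "k < 5" "l \<in> carrier G" for k l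
        unfolding c_def using alg_rep_eq_imp_trace_sum[OF is_group id hom2 eq2] that by blast
      have "c g = 0" if "g \<in> carrier G" for g
      proof (rule kernel_trivial[OF \<phi>1 _ id assms(2) c1 _ _ that])
        show "is_rep2 ([0, 1, -1] ! k) (\<phi>2 k)" if "k < 3" for k
          using \<phi>2[of k] that by (auto simp: numeral_eq_Suc less_Suc_eq)
        fix A B :: "'a \<Rightarrow> 'f" and l
        assume AB: "\<And>s \<psi> g. g \<in> carrier G \<Longrightarrow> s\<^sup>2 = 3 \<Longrightarrow> is_rep2 s \<psi> \<Longrightarrow> mat_trace (\<psi> g) = A g + s * B g"
          and l: "l \<in> carrier G"
        have rep3: "is_rep2 s (\<phi>2 3)" and rep4: "is_rep2 (- s) (\<phi>2 4)"
          using \<phi>2[of 3] \<phi>2[of 4] by (simp_all add: numeral_eq_Suc)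
        have s': "(- s)\<^sup>2 = 3" using s by simp
        \<comment> \<open>Adding the sums for \<open>s\<close> and \<open>- s\<close> cancels the
          multiples of \<open>s\<close> and leaves twice the part with \<open>A\<close>.\<close>
        have "2 * (\<Sum>g\<in>carrier G. c g * A (g \<otimes> l)) =
            (\<Sum>g\<in>carrier G. c g * (A (g \<otimes> l) + s * B (g \<otimes> l))) + (\<Sum>g\<in>carrier G. c g * (A (g \<otimes> l) + - s * B (g \<otimes> l)))"
          by (simp add: sum_distrib_left algebra_simps flip: sum.distrib)
        also have "\<dots> = (\<Sum>g\<in>carrier G. c g * mat_trace (\<phi>2 3 (g \<otimes> l))) + (\<Sum>g\<in>carrier G. c g * mat_trace (\<phi>2 4 (g \<otimes> l)))"
          using AB[OF _ s rep3] AB[OF _ s' rep4] l by simp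
        also have "\<dots> = 0" using c2 l by simp
        finally show "(\<Sum>g\<in>carrier G. c g * A (g \<otimes> l)) = 0" using assms(1) by simp
      qed (use c2 in auto)
      then have "a g = b g" if "g \<in> carrier G" for g using that by (simp add: c_def)
      moreover have "a g = b g" if "g \<notin> carrier G" for g
        using that ab by (simp add: group_algebra_def)
      ultimately show "a = b" by blast
    qed
  qed
  then show ?thesis by (simp add: N_def units_of_DirProd units_of_product_group GL_def)
qed

text \<open>One representation over the extension does the work of the two with parameters
  \<open>s\<close> and \<open>- s\<close>: its traces give an equation P + s Q = 0 with P and Q from
  the base field, over which 1 and \<open>s\<close> are independent because 3 is not a square
  there.\<close>

lemma units_group_algebra_nonsplit:
  fixes \<iota> :: "'f::{field, finite} \<Rightarrow> 'e::field"
  assumes "(24 :: 'f) \<noteq> 0" and nonsquare: "\<nexists>z::'f. z\<^sup>2 = 3"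
    and ext: "field_extension_of_degree 2 \<iota>" and s: "s\<^sup>2 = \<iota> 3"
  shows "units_of (group_algebra TYPE('f) G) \<cong>
    product_group {..<4} (\<lambda>_::nat. GL 1 TYPE('f)) \<times>\<times>
      (product_group {..<3} (\<lambda>_::nat. GL 2 TYPE('f)) \<times>\<times> GL 2 TYPE('e))"
proof -
  have \<iota>: "field_hom \<iota>" using ext by (simp add: field_extension_of_degree_def)
  interpret field_hom \<iota> by fact
  have s: "s\<^sup>2 = 3" using s by (simp add: hom_numeral)
  obtain u v :: 'f where uv: "u\<^sup>2 + v\<^sup>2 = -1" using minus_one_sum_two_squares[where 'a = 'f] by auto
  have len: "length [0, 1, -1 :: 'f] = 3" by simp
  have ts: "t = 0 \<or> t\<^sup>2 = 1 \<or> t\<^sup>2 = 3" if "t \<in> set [0, 1, -1]" for t :: 'f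
    using that by auto
  obtain \<phi>1 \<phi>2 :: "nat \<Rightarrow> 'a \<Rightarrow> 'f mat"
    where \<phi>1: "\<And>k. k < 4 \<Longrightarrow> is_rep1 ([1, 1, -1, -1] ! k) ([1, -1, 1, -1] ! k) (\<phi>1 k)"
      and \<phi>2: "\<And>k. k < 3 \<Longrightarrow> is_rep2 ([0, 1, -1] ! k) (\<phi>2 k)"
    using reps_exist[OF ts len uv] by blast
  have "(\<iota> u)\<^sup>2 + (\<iota> v)\<^sup>2 = -1" using arg_cong[OF uv, of \<iota>] by (simp add: hom_add hom_power hom_uminus)
  then obtain \<psi> where \<psi>: "is_rep2 s \<psi>" using is_rep2_exists s by blast
  have hom1: "\<phi>1 k \<in> hom G (GL 1 TYPE('f))" if "k < 4" for k using \<phi>1[OF that] is_rep1_def by blast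
  have hom2: "\<phi>2 k \<in> hom G (GL 2 TYPE('f))" if "k < 3" for k using \<phi>2[OF that] is_rep2_def by blast
  have hom3: "\<psi> \<in> hom G (GL 2 TYPE('e))" using \<psi> is_rep2_def by blast
  have id: "field_hom (\<lambda>z::'f. z)" by unfold_locales auto
  define h where "h = (\<lambda>a. (\<lambda>k\<in>{..<4}. alg_rep G 1 (\<lambda>z. z) (\<phi>1 k) a,
    (\<lambda>k\<in>{..<3}. alg_rep G 2 (\<lambda>z. z) (\<phi>2 k) a, alg_rep G 2 \<iota> \<psi> a)))"
  define N where "N = product_group {..<4} (\<lambda>_::nat. ring_mat TYPE('f) 1 ()) \<times>\<times>
    (product_group {..<3} (\<lambda>_::nat. ring_mat TYPE('f) 2 ()) \<times>\<times> ring_mat TYPE('e) 2 ())"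
  note rep_one = alg_rep_one[OF is_group finite_carrier id]
  note rep_mult = alg_rep_mult[OF is_group finite_carrier id]
  have "units_of (group_algebra TYPE('f) G) \<cong> units_of N"
  proof (rule units_group_algebra_iso[OF is_group finite_carrier, where h = h])
    show "h \<in> hom (group_algebra TYPE('f) G) N"
      by (rule homI) (auto simp del: One_nat_def simp: h_def N_def ring_mat_simps rep_mult[OF hom1] rep_mult[OF hom2]
          alg_rep_mult[OF is_group finite_carrier \<iota> hom3] cong: restrict_cong)
    show "h \<one>\<^bsub>group_algebra TYPE('f) G\<^esub> = \<one>\<^bsub>N\<^esub>"
      by (auto simp del: One_nat_def simp: h_def N_def ring_mat_simps rep_one[OF hom1] rep_one[OF hom2]
          alg_rep_one[OF is_group finite_carrier \<iota> hom3] cong: restrict_cong)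
    have card1: "finite (carrier_mat 1 1 :: 'f mat set)" "card (carrier_mat 1 1 :: 'f mat set) = CARD('f)"
      and card2: "finite (carrier_mat 2 2 :: 'f mat set)" "card (carrier_mat 2 2 :: 'f mat set) = CARD('f) ^ 4"
      by (rule card_carrier_mat_1 card_carrier_mat_2; simp)+
    note card3 = card_carrier_mat_2[OF card_field_extension_of_degree_2(1)[OF ext]]
    show "finite (carrier N)"
      unfolding N_def carrier_DirProd carrier_product_group ring_mat_simps
      using card1 card2 card3 by (intro finite_cartesian_product finite_PiE) auto
    \<comment> \<open>Here 4 * 1 + 3 * 4 + 2 * 4 = 24, where the last term counts four entries from
      a field of size q^2.\<close>
    show "card (carrier N) = CARD('f) ^ card (carrier G)"
      unfolding N_def carrier_DirProd carrier_product_group ring_mat_simps card_cartesian_product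
      by (simp add: card_PiE card1[simplified] card2 card3 card_field_extension_of_degree_2(2)[OF ext] card_carrier
          flip: power_mult power_add)
    show "inj_on h (carrier (group_algebra TYPE('f) G))"
    proof (rule inj_onI)
      fix a b assume ab: "a \<in> carrier (group_algebra TYPE('f) G)" "b \<in> carrier (group_algebra TYPE('f) G)"
        and hab: "h a = h b"
      have eq1: "alg_rep G 1 (\<lambda>z. z) (\<phi>1 k) a = alg_rep G 1 (\<lambda>z. z) (\<phi>1 k) b" if "k < 4" for k
        using arg_cong[OF hab, of "\<lambda>z. fst z k"] that by (simp add: h_def del: One_nat_def)
      have eq2: "alg_rep G 2 (\<lambda>z. z) (\<phi>2 k) a = alg_rep G 2 (\<lambda>z. z) (\<phi>2 k) b" if "k < 3" for k
        using arg_cong[OF hab, of "\<lambda>z. fst (snd z) k"] that by (simp add: h_def del: One_nat_def)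
      from hab have eq3: "alg_rep G 2 \<iota> \<psi> a = alg_rep G 2 \<iota> \<psi> b"
        unfolding h_def prod.inject by blast
      define c where "c = (\<lambda>g. a g - b g)"
      have c1: "(\<Sum>g\<in>carrier G. c g * mat_trace (\<phi>1 k (g \<otimes> l))) = 0" if "k < 4" "l \<in> carrier G" for k l
        unfolding c_def using alg_rep_eq_imp_trace_sum[OF is_group id hom1 eq1] that by blast
      have c2: "(\<Sum>g\<in>carrier G. c g * mat_trace (\<phi>2 k (g \<otimes> l))) = 0" if "k < 3" "l \<in> carrier G" for k l
        unfolding c_def using alg_rep_eq_imp_trace_sum[OF is_group id hom2 eq2] that by blast
      have c3: "(\<Sum>g\<in>carrier G. \<iota> (c g) * mat_trace (\<psi> (g \<otimes> l))) = 0" if "l \<in> carrier G" for l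
        unfolding c_def using alg_rep_eq_imp_trace_sum[OF is_group \<iota> hom3 eq3] that by blast
      have "c g = 0" if "g \<in> carrier G" for g
      proof (rule kernel_trivial[OF \<phi>1 \<phi>2 \<iota> assms(1) c1 c2 _ that])
        fix A B :: "'a \<Rightarrow> 'f" and l
        assume AB: "\<And>s \<psi> g. g \<in> carrier G \<Longrightarrow> s\<^sup>2 = 3 \<Longrightarrow> is_rep2 s \<psi> \<Longrightarrow> mat_trace (\<psi> g) = \<iota> (A g) + s * \<iota> (B g)"
          and l: "l \<in> carrier G"
        define P where "P = (\<Sum>g\<in>carrier G. c g * A (g \<otimes> l))"
        define Q where "Q = (\<Sum>g\<in>carrier G. c g * B (g \<otimes> l))"
        have "\<iota> P + s * \<iota> Q = (\<Sum>g\<in>carrier G. \<iota> (c g) * (\<iota> (A (g \<otimes> l)) + s * \<iota> (B (g \<otimes> l))))"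
          by (simp add: P_def Q_def hom_sum hom_mult sum_distrib_left algebra_simps flip: sum.distrib)
        also have "\<dots> = (\<Sum>g\<in>carrier G. \<iota> (c g) * mat_trace (\<psi> (g \<otimes> l)))"
          using AB[OF _ s \<psi>] l by simp
        finally have PQ: "\<iota> P + s * \<iota> Q = 0" using c3[OF l] by simp
        have "Q = 0"
        proof (rule ccontr)
          assume "Q \<noteq> 0"
          have "(\<iota> P)\<^sup>2 = s\<^sup>2 * (\<iota> Q)\<^sup>2"
            using PQ by (metis add_eq_0_iff power2_minus power_mult_distrib)
          then have "\<iota> (P\<^sup>2) = \<iota> (3 * Q\<^sup>2)" by (simp add: s hom_power hom_mult hom_numeral)
          then have "P\<^sup>2 = 3 * Q\<^sup>2" by simp
          then have "(P / Q)\<^sup>2 = 3" using \<open>Q \<noteq> 0\<close> by (simp add: power_divide)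
          then show False using nonsquare by blast
        qed
        then show "(\<Sum>g\<in>carrier G. c g * A (g \<otimes> l)) = 0" using PQ by (simp flip: P_def)
      qed
      then have "a g = b g" if "g \<in> carrier G" for g using that by (simp add: c_def)
      moreover have "a g = b g" if "g \<notin> carrier G" for g
        using that ab by (simp add: group_algebra_def)
      ultimately show "a = b" by blast
    qed
  qed
  then show ?thesis by (simp add: N_def units_of_DirProd units_of_product_group GL_def)
qed

end

theorem theorem2p6:
  fixes G :: "('g, 'm) monoid_scheme"
    and p k q :: nat
  assumes "CHAR('f::{field, finite}) = p"
    and "CARD('f) = q"
    and "q = p ^ k"
    and "is_C3_semidirect_Q8 G"
    and "p > 3"
  shows "([int q = 1] (mod 12) \<or> [int q = -1] (mod 12) \<longrightarrow>
           units_of (group_algebra TYPE('f) G) \<cong>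
             group_power (integer_mod_group (p ^ k - 1)) 4 \<times>\<times> group_power (GL 2 TYPE('f)) 5) \<and>
         ([int q = 5] (mod 12) \<or> [int q = -5] (mod 12) \<longrightarrow>
           (\<forall>\<iota> :: 'f \<Rightarrow> 'e::field. field_extension_of_degree 2 \<iota> \<longrightarrow>
             units_of (group_algebra TYPE('f) G) \<cong>
               group_power (integer_mod_group (p ^ k - 1)) 4 \<times>\<times>
                 (group_power (GL 2 TYPE('f)) 3 \<times>\<times> GL 2 TYPE('e))))"
proof -
  obtain f where pres: "presented_by G f C3_Q8_relations"
    using assms(4) by (auto simp: is_C3_semidirect_Q8_def)
  interpret C3_Q8 G f
    using pres by (simp add: C3_Q8_def C3_Q8_axioms_def presented_by_def)
  \<comment> \<open>Characteristic above 3 makes 2 and 3, and hence the group order 24,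
    invertible.\<close>
  have "of_nat n \<noteq> (0 :: 'f)" if "0 < n" "n \<le> 3" for n
    using that assms(1,5) by (auto simp: of_nat_eq_0_iff_char_dvd dest: dvd_imp_le)
  from this[of 2] this[of 3] have 2: "(2 :: 'f) \<noteq> 0" and 3: "(3 :: 'f) \<noteq> 0" by simp_all
  have "(24 :: 'f) = 2 * 2 * 2 * 3" by simp
  then have 24: "(24 :: 'f) \<noteq> 0" using 2 3 by (metis mult_eq_0_iff)
  have q: "CARD('f) = p ^ k" using assms by simp
  have cyc: "product_group {..<4} (\<lambda>_::nat. GL 1 TYPE('f)) \<cong> group_power (integer_mod_group (p ^ k - 1)) 4"
    unfolding group_power_def using GL_1_iso_integer_mod_group[where 'f = 'f] q
    by (intro iso_product_groupI) (simp_all add: group_GL)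
  have group_cyc: "Group.group (product_group {..<4} (\<lambda>_::nat. GL 1 TYPE('f)))"
    by (intro product_group group_GL)
  show ?thesis
  proof (intro conjI impI allI)
    assume "[int q = 1] (mod 12) \<or> [int q = -1] (mod 12)"
    then have "int (q mod 12) = 1 \<or> int (q mod 12) = 11" by (simp add: cong_def of_nat_mod)
    then have "q mod 12 = 1 \<or> q mod 12 = 11" by linarith
    then obtain s :: 'f where "s\<^sup>2 = 3"
      using three_square_iff[OF _ 2 3] assms(2) by auto
    then show "units_of (group_algebra TYPE('f) G) \<cong>
        group_power (integer_mod_group (p ^ k - 1)) 4 \<times>\<times> group_power (GL 2 TYPE('f)) 5"
      using units_group_algebra_split[OF 2 24] group.DirProd_iso_trans[OF group_cyc cyc iso_refl] iso_trans
      unfolding group_power_def by blast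
  next
    fix \<iota> :: "'f \<Rightarrow> 'e" assume ext: "field_extension_of_degree 2 \<iota>"
    assume "[int q = 5] (mod 12) \<or> [int q = -5] (mod 12)"
    then have "int (q mod 12) = 5 \<or> int (q mod 12) = 7" by (simp add: cong_def of_nat_mod)
    then have q57: "q mod 12 = 5 \<or> q mod 12 = 7" by linarith
    then have nonsq: "\<nexists>z::'f. z\<^sup>2 = 3"
      using three_square_iff[OF _ 2 3] assms(2) by auto
    \<comment> \<open>For odd q, every element of the base field, in particular 3, has a square root
      in the quadratic extension.\<close>
    have "odd q" using q57 by presburger
    then obtain s where "s\<^sup>2 = \<iota> 3"
      using square_in_quadratic_extension[OF ext] assms(2) by blast
    then show "units_of (group_algebra TYPE('f) G) \<cong>
        group_power (integer_mod_group (p ^ k - 1)) 4 \<times>\<times> (group_power (GL 2 TYPE('f)) 3 \<times>\<times> GL 2 TYPE('e))"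
      using units_group_algebra_nonsplit[OF 24 nonsq ext] group.DirProd_iso_trans[OF group_cyc cyc iso_refl] iso_trans
      unfolding group_power_def by blast
  qed
qed

end
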